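(* Let $M_1, M_2$ be two word-hyperbolic monoids with $1$-uniqueness (respectively, with uniqueness). Then the monoid free product $M_1\ast M_2$ is word-hyperbolic with $1$-uniqueness (respectively, with uniqueness).
   Context: For a word $w = a_1\cdots a_n$ write $w^{\mathrm{rev}} = a_n\cdots a_1$. Let $M$ be a monoid generated by a finite set $A$, with associated surjective homomorphism $\pi_M\colon A^\ast\to M$; $u=_M v$ means $\pi_M(u)=\pi_M(v)$. A regular combing of $M$ is a regular language $R\subseteq A^\ast$ with $\pi_M(R)=M$; it is a combing with uniqueness if $\pi_M$ restricted to $R$ is bijective. Let $\#_1,\#_2$ be new symbols not in $A$, and let $\mathcal{T}_M(R)=\{u\#_1 v\#_2 w^{\mathrm{rev}}\mid u,v,w\in R,\ u\cdot v=_M w\}$. The monoid $M$ is word-hyperbolic with respect to $R$ if $\mathcal{T}_M(R)$ is a context-free language, and word-hyperbolic if this holds for some finite generating set and some regular combing. $M$ is word-hyperbolic with uniqueness if it is word-hyperbolic with respect to some regular combing with uniqueness. $M$ is word-hyperbolic with $1$-uniqueness if it is word-hyperbolic with respect to some regular combing $R$ such that the only word in $R$ representing the identity element of $M$ is the empty word. The monoid free product of $M_1=\mathrm{Mon}\langle A_1\mid\mathscr{R}_1\rangle$ and $M_2=\mathrm{Mon}\langle A_2\mid\mathscr{R}_2\rangle$ with $A_1\cap A_2=\varnothing$ is $\mathrm{Mon}\langle A_1\cup A_2\mid\mathscr{R}_1\cup\mathscr{R}_2\rangle$, i.e. the coproduct in the category of monoids. *)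

theory Defs
  imports "HOL-Algebra.Group"
begin

section \<open>Regular and context-free languages\<close>

text \<open>Languages accepted by finite deterministic automata. Taking the states in \<^typ>\<open>nat\<close> is no
  restriction, as only finitely many of them occur.\<close>

definition regular_language :: "'a set \<Rightarrow> 'a list set \<Rightarrow> bool" where
  "regular_language A L \<longleftrightarrow>
     (\<exists>(Q :: nat set) \<delta> q0 F. finite Q \<and> q0 \<in> Q \<and> F \<subseteq> Q \<and> (\<forall>q\<in>Q. \<forall>a\<in>A. \<delta> q a \<in> Q) \<and>
        L = {w \<in> lists A. foldl \<delta> q0 w \<in> F})"

datatype ('n, 't) symbol = Nonterminal 'n | Terminal 't

type_synonym ('n, 't) productions = "('n \<times> ('n, 't) symbol list) set"

inductive derivation_step ::
  "('n, 't) productions \<Rightarrow> ('n, 't) symbol list \<Rightarrow> ('n, 't) symbol list \<Rightarrow> bool"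
  for P where
  "(N, \<alpha>) \<in> P \<Longrightarrow> derivation_step P (u @ [Nonterminal N] @ v) (u @ \<alpha> @ v)"

definition generated_language :: "('n, 't) productions \<Rightarrow> 'n \<Rightarrow> 't list set" where
  "generated_language P S = {w. (derivation_step P)\<^sup>*\<^sup>* [Nonterminal S] (map Terminal w)}"

text \<open>A finite set of productions involves only finitely many nonterminals and terminals, so that
  nonterminals may be taken in \<^typ>\<open>nat\<close>.\<close>

definition context_free :: "'t list set \<Rightarrow> bool" where
  "context_free L \<longleftrightarrow>
     (\<exists>(P :: (nat, 't) productions) S. finite P \<and> L = generated_language P S)"


section \<open>Word-hyperbolic monoids\<close>

definition free_monoid :: "'a set \<Rightarrow> 'a list monoid" where
  "free_monoid A = \<lparr>carrier = lists A, mult = (@), one = []\<rparr>"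

definition generated_via :: "('m, 'x) monoid_scheme \<Rightarrow> 'a set \<Rightarrow> ('a list \<Rightarrow> 'm) \<Rightarrow> bool" where
  "generated_via M A \<pi> \<longleftrightarrow>
     finite A \<and> \<pi> \<in> hom (free_monoid A) M \<and> \<pi> [] = \<one>\<^bsub>M\<^esub> \<and> \<pi> ` lists A = carrier M"

definition regular_combing ::
  "('m, 'x) monoid_scheme \<Rightarrow> 'a set \<Rightarrow> ('a list \<Rightarrow> 'm) \<Rightarrow> 'a list set \<Rightarrow> bool" where
  "regular_combing M A \<pi> R \<longleftrightarrow> regular_language A R \<and> \<pi> ` R = carrier M"

datatype 'a marked = Letter 'a | Hash1 | Hash2

definition multiplication_table :: "('a list \<Rightarrow> 'm) \<Rightarrow> 'a list set \<Rightarrow> 'a marked list set" where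
  "multiplication_table \<pi> R =
     {map Letter u @ [Hash1] @ map Letter v @ [Hash2] @ map Letter (rev w) | u v w.
        u \<in> R \<and> v \<in> R \<and> w \<in> R \<and> \<pi> (u @ v) = \<pi> w}"

definition word_hyperbolic_wrt ::
  "('m, 'x) monoid_scheme \<Rightarrow> 'a set \<Rightarrow> ('a list \<Rightarrow> 'm) \<Rightarrow> 'a list set \<Rightarrow> bool" where
  "word_hyperbolic_wrt M A \<pi> R \<longleftrightarrow>
     generated_via M A \<pi> \<and> regular_combing M A \<pi> R \<and> context_free (multiplication_table \<pi> R)"

text \<open>The alphabet is an abstract finite set mapped into the monoid by \<open>\<pi>\<close>, not necessarily
  injectively; up to renaming of letters it may be taken in \<^typ>\<open>nat\<close>.\<close>

definition word_hyperbolic_with_uniqueness :: "('m, 'x) monoid_scheme \<Rightarrow> bool" where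
  "word_hyperbolic_with_uniqueness M \<longleftrightarrow>
     (\<exists>(A :: nat set) \<pi> R. word_hyperbolic_wrt M A \<pi> R \<and> bij_betw \<pi> R (carrier M))"

definition word_hyperbolic_with_1_uniqueness :: "('m, 'x) monoid_scheme \<Rightarrow> bool" where
  "word_hyperbolic_with_1_uniqueness M \<longleftrightarrow>
     (\<exists>(A :: nat set) \<pi> R. word_hyperbolic_wrt M A \<pi> R \<and> {w \<in> R. \<pi> w = \<one>\<^bsub>M\<^esub>} = {[]})"


section \<open>Monoid presentations\<close>

inductive_set presentation_congruence ::
  "'a set \<Rightarrow> ('a list \<times> 'a list) set \<Rightarrow> ('a list \<times> 'a list) set"
  for A :: "'a set" and \<R> :: "('a list \<times> 'a list) set" where
  relation: "(u, v) \<in> \<R> \<Longrightarrow> x \<in> lists A \<Longrightarrow> y \<in> lists A \<Longrightarrow>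
    (x @ u @ y, x @ v @ y) \<in> presentation_congruence A \<R>"
| refl: "u \<in> lists A \<Longrightarrow> (u, u) \<in> presentation_congruence A \<R>"
| sym: "(u, v) \<in> presentation_congruence A \<R> \<Longrightarrow> (v, u) \<in> presentation_congruence A \<R>"
| trans: "(u, v) \<in> presentation_congruence A \<R> \<Longrightarrow> (v, w) \<in> presentation_congruence A \<R> \<Longrightarrow>
    (u, w) \<in> presentation_congruence A \<R>"

definition presented_monoid :: "'a set \<Rightarrow> ('a list \<times> 'a list) set \<Rightarrow> 'a list set monoid" where
  "presented_monoid A \<R> =
     \<lparr>carrier = lists A // presentation_congruence A \<R>,
      mult = (\<lambda>X Y. \<Union>x\<in>X. \<Union>y\<in>Y. presentation_congruence A \<R> `` {x @ y}),
      one = presentation_congruence A \<R> `` {[]}\<rparr>"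

definition has_presentation ::
  "('m, 'x) monoid_scheme \<Rightarrow> 'a set \<Rightarrow> ('a list \<times> 'a list) set \<Rightarrow> bool" where
  "has_presentation M A \<R> \<longleftrightarrow>
     monoid M \<and> \<R> \<subseteq> lists A \<times> lists A \<and> M \<cong> presented_monoid A \<R>"

context
  fixes A :: "'a set" and \<R> :: "('a list \<times> 'a list) set"
  assumes rel: "\<R> \<subseteq> lists A \<times> lists A"
begin

lemma presentation_congruence_in_lists:
  "(u, v) \<in> presentation_congruence A \<R> \<Longrightarrow> u \<in> lists A \<and> v \<in> lists A"
  by (induction rule: presentation_congruence.induct) (use rel in auto)

lemma equiv_presentation_congruence: "equiv (lists A) (presentation_congruence A \<R>)"
  using presentation_congruence_in_lists
  by (intro equivI refl_onI symI transI)
     (auto intro: presentation_congruence.intros)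

lemma presentation_congruence_context:
  assumes "(u, v) \<in> presentation_congruence A \<R>" "x \<in> lists A" "y \<in> lists A"
  shows "(x @ u @ y, x @ v @ y) \<in> presentation_congruence A \<R>"
  using assms
proof (induction rule: presentation_congruence.induct)
  case (relation u v x' y')
  then show ?case
    using presentation_congruence.relation[of u v \<R> "x @ x'" A "y' @ y"] by simp
next
  case (refl u)
  then show ?case
    by (intro presentation_congruence.refl) simp
qed (blast intro: presentation_congruence.sym presentation_congruence.trans)+

lemma presentation_congruence_append:
  assumes "(u, u') \<in> presentation_congruence A \<R>" "(v, v') \<in> presentation_congruence A \<R>"
  shows "(u @ v, u' @ v') \<in> presentation_congruence A \<R>"
  using presentation_congruence_context[OF assms(1), of "[]" v]
    presentation_congruence_context[OF assms(2), of u' "[]"] assms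
  by (auto dest: presentation_congruence_in_lists intro: presentation_congruence.trans)

lemma presented_monoid_mult_class:
  assumes "u \<in> lists A" "v \<in> lists A"
  shows "presentation_congruence A \<R> `` {u} \<otimes>\<^bsub>presented_monoid A \<R>\<^esub>
           presentation_congruence A \<R> `` {v} = presentation_congruence A \<R> `` {u @ v}"
  unfolding presented_monoid_def monoid.simps
  by (rule UN_equiv_class2[OF equiv_presentation_congruence equiv_presentation_congruence _ assms])
     (auto simp: congruent2_def intro!: equiv_class_eq[OF equiv_presentation_congruence]
       presentation_congruence_append)

lemma monoid_presented_monoid: "monoid (presented_monoid A \<R>)"
proof -
  have carrier: "carrier (presented_monoid A \<R>) = lists A // presentation_congruence A \<R>"
    and one: "\<one>\<^bsub>presented_monoid A \<R>\<^esub> = presentation_congruence A \<R> `` {[]}"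
    by (simp_all add: presented_monoid_def)
  have Nil: "[] \<in> lists A" and append: "\<And>u v. u \<in> lists A \<Longrightarrow> v \<in> lists A \<Longrightarrow> u @ v \<in> lists A"
    by simp_all
  show ?thesis
    by (rule monoidI; unfold carrier one; (elim quotientE)?)
       (simp_all add: presented_monoid_mult_class Nil append quotientI del: in_lists_conv_set)
qed

end

end

theory Submission
  imports Defs "HOL-Library.Countable"
begin

text \<open>Let \<open>e\<^sub>i\<close> be the only word of the combing \<open>R\<^sub>i\<close> that represents the identity. The
  free product is combed by the concatenations of words taken alternately from \<open>R\<^sub>1 - {e\<^sub>1}\<close>
  and \<open>R\<^sub>2 - {e\<^sub>2}\<close>; by the normal form theorem for free products this combing inherits uniqueness,
  and only the empty word represents the identity. In a product of two normal forms, factors cancel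
  around the seam until two adjacent factors do not cancel; these are either merged or left alone, and
  all other factors are copied to the result. The grammar
  \<^item> \<open>Product \<rightarrow> x Product z\<^sup>r\<^sup>e\<^sup>v\<close> for \<open>x = z\<close>, \<open>Product \<rightarrow> x Cancel y Copy z\<^sup>r\<^sup>e\<^sup>v\<close> for \<open>x y = z\<close>,
    \<open>Product \<rightarrow> Cancel Copy\<close>,
  \<^item> \<open>Cancel \<rightarrow> x Cancel y\<close> for \<open>x y = 1\<close>, \<open>Cancel \<rightarrow> #\<^sub>1\<close>,
  \<^item> \<open>Copy \<rightarrow> x Copy z\<^sup>r\<^sup>e\<^sup>v\<close> for \<open>x = z\<close>, \<open>Copy \<rightarrow> #\<^sub>2\<close>,

  with \<open>x, y, z\<close> in a common \<open>R\<^sub>i\<close>, generates only correct products and at least all products of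
  normal forms. Its right-hand sides form context-free languages, obtained from the multiplication
  tables of the factors by replacing markers and erasing an occurrence of \<open>e\<^sub>i\<close>. Intersecting with
  the words whose three parts lie in the combing gives the multiplication table.\<close>

section \<open>Context-free languages\<close>

text \<open>Derivations of terminal words in parse-tree form. Unlike sequences of single rewriting
  steps, they decompose along concatenation and admit structural induction;
  \<open>yields_iff_derivation\<close> shows that both notions agree.\<close>

inductive yields :: "('n, 't) productions \<Rightarrow> ('n, 't) symbol list \<Rightarrow> 't list \<Rightarrow> bool"
  for P where
  yields_Nil: "yields P [] []"
| yields_Terminal: "yields P \<alpha> w \<Longrightarrow> yields P (Terminal a # \<alpha>) (a # w)"
| yields_Nonterminal: "(N, \<beta>) \<in> P \<Longrightarrow> yields P \<beta> v \<Longrightarrow> yields P \<alpha> w \<Longrightarrow>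
    yields P (Nonterminal N # \<alpha>) (v @ w)"

inductive_cases yields_NilE: "yields P [] w"
inductive_cases yields_TerminalE: "yields P (Terminal a # \<alpha>) w"
inductive_cases yields_NonterminalE: "yields P (Nonterminal N # \<alpha>) w"

lemma yields_append:
  "yields P (\<alpha> @ \<beta>) w \<longleftrightarrow> (\<exists>u v. w = u @ v \<and> yields P \<alpha> u \<and> yields P \<beta> v)"
proof (induction \<alpha> arbitrary: w)
  case Nil
  show ?case by (auto intro: yields_Nil elim: yields_NilE)
next
  case (Cons s \<alpha>)
  show ?case
  proof (cases s)
    case [simp]: (Nonterminal N)
    show ?thesis
    proof
      assume "yields P ((s # \<alpha>) @ \<beta>) w"
      then show "\<exists>u v. w = u @ v \<and> yields P (s # \<alpha>) u \<and> yields P \<beta> v"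
        by (simp, elim yields_NonterminalE) (metis Cons.IH append_assoc yields_Nonterminal)
    next
      assume "\<exists>u v. w = u @ v \<and> yields P (s # \<alpha>) u \<and> yields P \<beta> v"
      then show "yields P ((s # \<alpha>) @ \<beta>) w"
        by (simp, elim exE conjE yields_NonterminalE) (metis Cons.IH append_assoc yields_Nonterminal)
    qed
  next
    case [simp]: (Terminal a)
    show ?thesis
    proof
      assume "yields P ((s # \<alpha>) @ \<beta>) w"
      then show "\<exists>u v. w = u @ v \<and> yields P (s # \<alpha>) u \<and> yields P \<beta> v"
        by (simp, elim yields_TerminalE) (metis Cons.IH append_Cons yields_Terminal)
    next
      assume "\<exists>u v. w = u @ v \<and> yields P (s # \<alpha>) u \<and> yields P \<beta> v"
      then show "yields P ((s # \<alpha>) @ \<beta>) w"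
        by (simp, elim exE conjE yields_TerminalE) (metis Cons.IH append_Cons yields_Terminal)
    qed
  qed
qed

lemma yields_appendI: "yields P \<alpha> u \<Longrightarrow> yields P \<beta> v \<Longrightarrow> yields P (\<alpha> @ \<beta>) (u @ v)"
  by (auto simp: yields_append)

lemma yields_map_Terminal [simp]: "yields P (map Terminal u) w \<longleftrightarrow> w = u"
  by (induction u arbitrary: w)
    (auto elim!: yields_NilE yields_TerminalE intro: yields_Nil yields_Terminal)

lemma yields_single: "yields P [Nonterminal N] w \<longleftrightarrow> (\<exists>\<beta>. (N, \<beta>) \<in> P \<and> yields P \<beta> w)"
  by (metis append_Nil2 yields_Nil yields_NilE yields_Nonterminal yields_NonterminalE)

lemma derivation_context:
  assumes "(derivation_step P)\<^sup>*\<^sup>* \<alpha> \<beta>"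
  shows "(derivation_step P)\<^sup>*\<^sup>* (u @ \<alpha> @ v) (u @ \<beta> @ v)"
  using assms
proof (induction rule: rtranclp_induct)
  case (step \<beta> \<gamma>)
  from step(2) have "derivation_step P (u @ \<beta> @ v) (u @ \<gamma> @ v)"
  proof cases
    case (1 N \<delta> x y)
    then show ?thesis
      using derivation_step.intros[of N \<delta> P "u @ x" "y @ v"] by simp
  qed
  with step(3) show ?case by simp
qed simp

text \<open>Forwards, the leading nonterminal is expanded and the two pieces are then rewritten one
  after the other in context. Backwards, the induction runs from the end of the derivation:
  \<open>yields_append\<close> isolates the nonterminal that the first step replaced.\<close>

lemma yields_iff_derivation: "yields P \<alpha> w \<longleftrightarrow> (derivation_step P)\<^sup>*\<^sup>* \<alpha> (map Terminal w)"
proof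
  show "(derivation_step P)\<^sup>*\<^sup>* \<alpha> (map Terminal w)" if "yields P \<alpha> w"
    using that
  proof induction
    case (yields_Terminal \<alpha> w a)
    then show ?case
      using derivation_context[of P \<alpha> "map Terminal w" "[Terminal a]" "[]"] by simp
  next
    case (yields_Nonterminal N \<beta> v \<alpha> w)
    have "derivation_step P (Nonterminal N # \<alpha>) (\<beta> @ \<alpha>)"
      using derivation_step.intros[OF yields_Nonterminal(1), of "[]" \<alpha>] by simp
    moreover have "(derivation_step P)\<^sup>*\<^sup>* (\<beta> @ \<alpha>) (map Terminal v @ \<alpha>)"
      using derivation_context[OF yields_Nonterminal(4), of "[]" \<alpha>] by simp
    moreover have "(derivation_step P)\<^sup>*\<^sup>* (map Terminal v @ \<alpha>) (map Terminal v @ map Terminal w)"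
      using derivation_context[OF yields_Nonterminal(5), of "map Terminal v" "[]"] by simp
    ultimately show ?case
      by (metis (no_types, lifting) converse_rtranclp_into_rtranclp map_append rtranclp_trans)
  qed simp
  show "yields P \<alpha> w" if "(derivation_step P)\<^sup>*\<^sup>* \<alpha> (map Terminal w)"
    using that
  proof (induction rule: converse_rtranclp_induct)
    case (step \<alpha> \<beta>)
    from step(1) show ?case
    proof cases
      case (1 N \<delta> x y)
      with step(3) show ?thesis
        by (auto simp: yields_append yields_single simp del: append_Cons) metis
    qed
  qed simp
qed

lemma generated_language_eq: "generated_language P S = {w. yields P [Nonterminal S] w}"
  by (simp add: generated_language_def yields_iff_derivation)

fun interp :: "('n \<Rightarrow> 't list set) \<Rightarrow> ('n, 't) symbol list \<Rightarrow> 't list set" where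
  "interp I [] = {[]}"
| "interp I (Terminal a # \<alpha>) = {a # w |w. w \<in> interp I \<alpha>}"
| "interp I (Nonterminal N # \<alpha>) = {v @ w |v w. v \<in> I N \<and> w \<in> interp I \<alpha>}"

lemma interp_map_Terminal [simp]: "interp I (map Terminal u) = {u}"
  by (induction u) auto

lemma interp_append: "interp I (\<alpha> @ \<beta>) = {u @ v |u v. u \<in> interp I \<alpha> \<and> v \<in> interp I \<beta>}"
proof (induction I \<alpha> rule: interp.induct)
  case (2 I a \<alpha>)
  show ?case
    unfolding append_Cons interp.simps 2 by (auto, metis append_Cons, blast)
next
  case (3 I N \<alpha>)
  show ?case
    unfolding append_Cons interp.simps 3 by (blast intro: append_assoc append_assoc[symmetric])
qed simp

text \<open>The generated languages form the least solution of the inclusions given by the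
  productions, so any assignment \<open>I\<close> closed under the productions bounds them from
  above. Soundness of the extended grammars, of the triple construction and of the product grammar
  is proved through this principle.\<close>

lemma yields_in_interp:
  assumes "yields P \<alpha> w" and "\<And>N \<beta>. (N, \<beta>) \<in> P \<Longrightarrow> interp I \<beta> \<subseteq> I N"
  shows "w \<in> interp I \<alpha>"
  using assms(1)
proof induction
  case (yields_Nonterminal N \<beta> v \<alpha> w)
  with assms(2)[of N \<beta>] show ?case by auto
qed auto

text \<open>Only finitely many nonterminals matter, and these can be numbered injectively. Later
  grammars may therefore use sums, triples or a datatype as nonterminals, although
  \<open>context_free\<close> asks for natural numbers.\<close>

lemma context_free_generated_language:
  fixes P :: "('n, 't) productions"
  assumes "finite P"
  shows "context_free (generated_language P S)"
proof -
  \<comment> \<open>The start symbol is included even if it occurs in no production, so that its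
    number cannot collide with that of another nonterminal.\<close>
  define X where "X = insert S (fst ` P \<union> {N. \<exists>\<alpha>\<in>snd ` P. Nonterminal N \<in> set \<alpha>})"
  have "finite {N. Nonterminal N \<in> set \<alpha>}" for \<alpha> :: "('n, 't) symbol list"
    by (rule finite_subset[of _ "(\<lambda>s. case s of Nonterminal N \<Rightarrow> N) ` set \<alpha>"])
      (force split: symbol.splits, simp)
  then have "finite X"
    using assms unfolding X_def by (simp add: Collect_bex_eq)
  from finite_imp_inj_to_nat_seg[OF this] obtain f :: "'n \<Rightarrow> nat" where f: "inj_on f X"
    by auto
  let ?h = "map_symbol f (\<lambda>t. t)"
  define P' where "P' = (\<lambda>(N, \<alpha>). (f N, map ?h \<alpha>)) ` P"
  have "yields P' (map ?h \<alpha>) w" if "yields P \<alpha> w" for \<alpha> w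
    using that
  proof induction
    case (yields_Nonterminal N \<beta> v \<alpha> w)
    then have "(f N, map ?h \<beta>) \<in> P'" by (force simp: P'_def)
    with yields_Nonterminal show ?case by (simp add: yields.yields_Nonterminal)
  qed (auto intro: yields.intros)
  moreover have "yields P \<alpha> w"
    if "yields P' \<beta> w" "\<beta> = map ?h \<alpha>" "{N. Nonterminal N \<in> set \<alpha>} \<subseteq> X" for \<alpha> \<beta> w
    using that
  proof (induction arbitrary: \<alpha>)
    case (yields_Terminal \<beta> w a)
    then obtain \<alpha>' where "\<alpha> = Terminal a # \<alpha>'" "\<beta> = map ?h \<alpha>'"
      by (cases \<alpha>; cases "hd \<alpha>") auto
    with yields_Terminal show ?case by (auto intro: yields.yields_Terminal)
  next
    case (yields_Nonterminal N \<gamma> v \<beta> w)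
    then obtain K \<alpha>' where \<alpha>: "\<alpha> = Nonterminal K # \<alpha>'" "\<beta> = map ?h \<alpha>'" "N = f K"
      by (cases \<alpha>; cases "hd \<alpha>") auto
    from yields_Nonterminal(1) obtain K' \<delta> where K': "(K', \<delta>) \<in> P" "N = f K'" "\<gamma> = map ?h \<delta>"
      by (auto simp: P'_def)
    \<comment> \<open>Injectivity on \<open>X\<close> identifies the nonterminal \<open>K\<close> of
      the sentential form with the left-hand side \<open>K'\<close> of the production whose renamed
      copy was applied.\<close>
    have "K \<in> X" "K' \<in> X" using \<alpha> K' yields_Nonterminal.prems by (force simp: X_def)+
    with f \<alpha> K' have "K = K'" by (auto dest: inj_onD)
    moreover have "{N. Nonterminal N \<in> set \<delta>} \<subseteq> X" using K'(1) by (force simp: X_def)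
    ultimately show ?case
      using yields_Nonterminal \<alpha> K' by (auto intro!: yields.yields_Nonterminal)
  qed (auto intro: yields.intros)
  ultimately have "yields P [Nonterminal S] w \<longleftrightarrow> yields P' [Nonterminal (f S)] w" for w
    using X_def by fastforce
  moreover have "finite P'" using assms by (simp add: P'_def)
  ultimately show ?thesis
    unfolding context_free_def generated_language_eq by auto
qed

section \<open>Grammars with context-free sets of right-hand sides\<close>

text \<open>An infinite but context-free set \<open>L\<close> of right-hand sides is replaced by a
  private copy of a grammar for \<open>L\<close>, whose start symbol becomes the only right-hand
  side. The nonterminals \<open>Inl k\<close> are the original ones, \<open>Inr (L, n)\<close> those
  of the copy for \<open>L\<close>.\<close>

lemma context_free_extended_grammar:
  fixes F :: "('k \<times> ('k, 't) symbol list set) set"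
  assumes "finite F" and CF: "\<And>k L. (k, L) \<in> F \<Longrightarrow> context_free L"
  shows "context_free (generated_language {(k, \<alpha>). \<exists>L. (k, L) \<in> F \<and> \<alpha> \<in> L} S)"
    (is "context_free (generated_language ?P S)")
proof -
  have "\<forall>L\<in>snd ` F. \<exists>(G :: (nat, ('k, 't) symbol) productions) s. finite G \<and> L = generated_language G s"
    using CF by (fastforce simp: context_free_def)
  then obtain G :: "_ \<Rightarrow> (nat, ('k, 't) symbol) productions" and s where
    G: "\<And>k L. (k, L) \<in> F \<Longrightarrow> finite (G L) \<and> L = generated_language (G L) (s L)"
    by (metis snd_conv image_eqI)
  \<comment> \<open>The terminals of \<open>G L\<close> are symbols of the outer grammar. Such a
    terminal that is itself an outer nonterminal \<open>k\<close> has to become the nonterminal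
    \<open>Inl k\<close> again.\<close>
  define emb where "emb L x = (case x of Nonterminal n \<Rightarrow> Nonterminal (Inr (L, n))
      | Terminal (Nonterminal k) \<Rightarrow> Nonterminal (Inl k) | Terminal (Terminal t) \<Rightarrow> Terminal t)"
    for L :: "('k, 't) symbol list set" and x :: "(nat, ('k, 't) symbol) symbol"
  define top :: "('k, 't) symbol \<Rightarrow> ('k + ('k, 't) symbol list set \<times> nat, 't) symbol"
    where "top = map_symbol Inl id"
  have top [simp]: "top (Nonterminal k) = Nonterminal (Inl k)" "top (Terminal t) = Terminal t" for k t
    by (simp_all add: top_def)
  have emb [simp]: "emb L (Nonterminal n) = Nonterminal (Inr (L, n))"
    "emb L (Terminal x) = top x" for L n x
    by (auto simp: emb_def split: symbol.splits)
  define Q where "Q = (\<lambda>(k, L). (Inl k, [Nonterminal (Inr (L, s L))])) ` F \<union>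
      (\<Union>(k, L)\<in>F. (\<lambda>(n, \<beta>). (Inr (L, n), map (emb L) \<beta>)) ` G L)"
  have finQ: "finite Q" using \<open>finite F\<close> G by (auto simp: Q_def)
  \<comment> \<open>A derivation inside \<open>G L\<close> and a derivation that continues from the
    resulting outer sentential form compose to a single derivation in \<open>Q\<close>.\<close>
  have expand: "yields Q (map (emb L) \<beta>) w"
    if "yields (G L) \<beta> \<alpha>" "yields Q (map top \<alpha>) w" "(k, L) \<in> F" for k L \<beta> \<alpha> w
    using that
  proof (induction arbitrary: w)
    case (yields_Terminal \<alpha> v a)
    then obtain x y where "w = x @ y" "yields Q [top a] x" "yields Q (map top v) y"
      using yields_append[of Q "[top a]" "map top v" w] by auto
    with yields_Terminal show ?case
      using yields_appendI[of Q "[top a]" x "map (emb L) \<alpha>" y] by simp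
  next
    case (yields_Nonterminal n \<beta> v \<alpha> u)
    then obtain w1 w2 where "w = w1 @ w2" "yields Q (map top v) w1" "yields Q (map top u) w2"
      by (auto simp: yields_append)
    moreover have "(Inr (L, n), map (emb L) \<beta>) \<in> Q"
      using yields_Nonterminal by (force simp: Q_def)
    ultimately show ?case
      using yields_Nonterminal by (auto intro: yields.intros)
  qed (auto intro: yields.intros)
  have "yields Q (map top \<alpha>) w" if "yields ?P \<alpha> w" for \<alpha> w
    using that
  proof induction
    case (yields_Nonterminal k \<beta> v \<alpha> w)
    then obtain L where L: "(k, L) \<in> F" "\<beta> \<in> L" by auto
    with G have "yields (G L) [Nonterminal (s L)] \<beta>"
      by (metis generated_language_eq mem_Collect_eq)
    from expand[OF this yields_Nonterminal(4) L(1)]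
    have "yields Q [Nonterminal (Inr (L, s L))] v" by simp
    moreover have "(Inl k, [Nonterminal (Inr (L, s L))]) \<in> Q" using L by (force simp: Q_def)
    ultimately show ?case using yields_Nonterminal by (auto intro: yields.intros)
  qed (auto intro: yields.intros)
  moreover have "yields ?P [Nonterminal S] w" if "yields Q [Nonterminal (Inl S)] w" for w
  proof -
    \<comment> \<open>An auxiliary nonterminal stands for all terminal words that the outer grammar
      yields from the sentential forms it derives in its own grammar.\<close>
    define I where "I x = (case x of Inl k \<Rightarrow> {w. yields ?P [Nonterminal k] w}
        | Inr (L, n) \<Rightarrow> {w. \<exists>\<alpha>. yields (G L) [Nonterminal n] \<alpha> \<and> yields ?P \<alpha> w})" for x
    have I [simp]: "I (Inl k) = {w. yields ?P [Nonterminal k] w}"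
      "I (Inr (L, n)) = {w. \<exists>\<alpha>. yields (G L) [Nonterminal n] \<alpha> \<and> yields ?P \<alpha> w}" for k L n
      by (simp_all add: I_def)
    have *: "\<exists>\<alpha>. yields (G L) \<beta> \<alpha> \<and> yields ?P \<alpha> w" if "w \<in> interp I (map (emb L) \<beta>)" for L \<beta> w
      using that
    proof (induction \<beta> arbitrary: w)
      case (Cons x \<beta>)
      consider n where "x = Nonterminal n" | k where "x = Terminal (Nonterminal k)"
        | t where "x = Terminal (Terminal t)"
        by (metis symbol.exhaust)
      then show ?case
      proof cases
        case 1
        with Cons.prems obtain u v \<alpha> where "w = u @ v" "v \<in> interp I (map (emb L) \<beta>)"
          "yields (G L) [Nonterminal n] \<alpha>" "yields ?P \<alpha> u"
          by auto
        with Cons.IH[of v] 1 yields_appendI[of "G L" "[x]" \<alpha> \<beta>] show ?thesis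
          by (auto intro: yields_appendI)
      next
        case 2
        with Cons.prems obtain u v where "w = u @ v" "v \<in> interp I (map (emb L) \<beta>)"
          "yields ?P [Nonterminal k] u"
          by auto
        with Cons.IH[of v] 2 yields_appendI[of ?P "[Nonterminal k]" u] show ?thesis
          by (auto intro: yields_Terminal)
      next
        case 3
        with Cons show ?thesis by (fastforce intro: yields_Terminal)
      qed
    qed (auto intro: yields.intros)
    have "interp I \<beta> \<subseteq> I N" if N: "(N, \<beta>) \<in> Q" for N \<beta>
    proof
      fix w assume w: "w \<in> interp I \<beta>"
      from N consider k L where "(k, L) \<in> F" "N = Inl k" "\<beta> = [Nonterminal (Inr (L, s L))]"
        | k L n \<gamma> where "(k, L) \<in> F" "N = Inr (L, n)" "(n, \<gamma>) \<in> G L" "\<beta> = map (emb L) \<gamma>"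
        by (auto simp: Q_def)
      then show "w \<in> I N"
      proof cases
        case 1
        with w obtain \<alpha> where "yields (G L) [Nonterminal (s L)] \<alpha>" "yields ?P \<alpha> w"
          by auto
        moreover have "\<alpha> \<in> L"
          using 1 G calculation by (metis generated_language_eq mem_Collect_eq)
        ultimately show ?thesis using 1 by (auto simp: yields_single)
      next
        case 2
        with w * show ?thesis by (force simp: yields_single)
      qed
    qed
    from yields_in_interp[OF that this] show ?thesis by simp
  qed
  ultimately have "generated_language ?P S = generated_language Q (Inl S)"
    by (fastforce simp: generated_language_eq)
  with context_free_generated_language[OF finQ] show ?thesis by simp
qed

section \<open>Finite transducers\<close>

inductive run :: "('s \<times> 'a \<times> 'b list \<times> 's) set \<Rightarrow> 's \<Rightarrow> 'a list \<Rightarrow> 'b list \<Rightarrow> 's \<Rightarrow> bool"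
  for \<Delta> where
  run_Nil: "run \<Delta> p [] [] p"
| run_Cons: "(p, a, x, q) \<in> \<Delta> \<Longrightarrow> run \<Delta> q w v r \<Longrightarrow> run \<Delta> p (a # w) (x @ v) r"

inductive_cases run_NilE: "run \<Delta> p [] v q"
inductive_cases run_ConsE: "run \<Delta> p (a # w) v q"

lemma run_append_iff:
  "run \<Delta> p (w @ w') v r \<longleftrightarrow> (\<exists>q x y. v = x @ y \<and> run \<Delta> p w x q \<and> run \<Delta> q w' y r)"
proof (induction w arbitrary: p v)
  case Nil
  show ?case by (metis append_Nil run_Nil run_NilE)
next
  case (Cons a w)
  show ?case
  proof
    assume "run \<Delta> p ((a # w) @ w') v r"
    then show "\<exists>q x y. v = x @ y \<and> run \<Delta> p (a # w) x q \<and> run \<Delta> q w' y r"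
      by (simp, elim run_ConsE) (metis Cons.IH append_assoc run_Cons)
  next
    assume "\<exists>q x y. v = x @ y \<and> run \<Delta> p (a # w) x q \<and> run \<Delta> q w' y r"
    then show "run \<Delta> p ((a # w) @ w') v r"
      by (simp, elim exE conjE run_ConsE) (metis Cons.IH append_assoc run_Cons)
  qed
qed

lemma run_append:
  "run \<Delta> p w x q \<Longrightarrow> run \<Delta> q w' y r \<Longrightarrow> run \<Delta> p (w @ w') (x @ y) r"
  by (auto simp: run_append_iff)

lemma run_in_states: "run \<Delta> p w v q \<Longrightarrow> p \<in> Q \<Longrightarrow> \<Delta> \<subseteq> Q \<times> UNIV \<times> UNIV \<times> Q \<Longrightarrow> q \<in> Q"
  by (induction rule: run.induct) auto

text \<open>Triple construction: the nonterminal \<open>(p, N, q)\<close> derives the outputs of the runs from \<open>p\<close>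
  to \<open>q\<close> on the words derived from \<open>N\<close>.\<close>

inductive lift_run :: "'s set \<Rightarrow> ('s \<times> 'a \<times> 'b list \<times> 's) set \<Rightarrow>
    's \<Rightarrow> ('n, 'a) symbol list \<Rightarrow> ('s \<times> 'n \<times> 's, 'b) symbol list \<Rightarrow> 's \<Rightarrow> bool"
  for Q \<Delta> where
  lift_Nil: "lift_run Q \<Delta> p [] [] p"
| lift_Terminal: "(p, a, x, q) \<in> \<Delta> \<Longrightarrow> lift_run Q \<Delta> q \<alpha> \<beta> r \<Longrightarrow>
    lift_run Q \<Delta> p (Terminal a # \<alpha>) (map Terminal x @ \<beta>) r"
| lift_Nonterminal: "q \<in> Q \<Longrightarrow> lift_run Q \<Delta> q \<alpha> \<beta> r \<Longrightarrow>
    lift_run Q \<Delta> p (Nonterminal N # \<alpha>) (Nonterminal (p, N, q) # \<beta>) r"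

inductive_cases lift_NilE: "lift_run Q \<Delta> p [] \<beta> q"
inductive_cases lift_TerminalE: "lift_run Q \<Delta> p (Terminal a # \<alpha>) \<beta> q"
inductive_cases lift_NonterminalE: "lift_run Q \<Delta> p (Nonterminal N # \<alpha>) \<beta> q"

text \<open>Keeps the triple grammar finite: each nonterminal of a right-hand side guesses one state
  of the finite set \<open>Q\<close>, and each terminal chooses one of finitely many
  transitions.\<close>

lemma finite_lift_run:
  assumes "finite Q" and "\<And>p a. finite {(x, q). (p, a, x, q) \<in> \<Delta>}"
  shows "finite {(\<beta>, q). lift_run Q \<Delta> p \<alpha> \<beta> q}"
proof (induction \<alpha> arbitrary: p)
  case Nil
  have "{(\<beta>, q). lift_run Q \<Delta> p [] \<beta> q} \<subseteq> {([], p)}" by (auto elim: lift_NilE)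
  then show ?case by (rule finite_subset) simp
next
  case (Cons s \<alpha>)
  show ?case
  proof (cases s)
    case (Terminal a)
    have "{(\<beta>, q). lift_run Q \<Delta> p (s # \<alpha>) \<beta> q} \<subseteq>
        (\<Union>(x, q)\<in>{(x, q). (p, a, x, q) \<in> \<Delta>}.
           (\<lambda>(\<beta>, r). (map Terminal x @ \<beta>, r)) ` {(\<beta>, r). lift_run Q \<Delta> q \<alpha> \<beta> r})"
      using Terminal by (force elim: lift_TerminalE)
    then show ?thesis by (rule finite_subset) (use Cons assms in auto)
  next
    case (Nonterminal N)
    have "{(\<beta>, q). lift_run Q \<Delta> p (s # \<alpha>) \<beta> q} \<subseteq>
        (\<Union>q\<in>Q. (\<lambda>(\<beta>, r). (Nonterminal (p, N, q) # \<beta>, r)) ` {(\<beta>, r). lift_run Q \<Delta> q \<alpha> \<beta> r})"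
      using Nonterminal by (force elim: lift_NonterminalE)
    then show ?thesis by (rule finite_subset) (use Cons assms in auto)
  qed
qed

text \<open>Runs split along concatenation, so a production of \<open>P\<close> can be annotated
  with the states reached between its symbols. Substituting for letters, erasing a fixed factor and
  intersecting with a regular language are all obtained from this one closure property.\<close>

lemma context_free_transduction:
  fixes L :: "'a list set" and \<Delta> :: "('s \<times> 'a \<times> 'b list \<times> 's) set"
  assumes L: "context_free L" and Q: "finite Q" "p\<^sub>0 \<in> Q" "q\<^sub>0 \<in> Q"
    and \<Delta>: "\<Delta> \<subseteq> Q \<times> UNIV \<times> UNIV \<times> Q" "\<And>p a. finite {(x, q). (p, a, x, q) \<in> \<Delta>}"
  shows "context_free {v. \<exists>w\<in>L. run \<Delta> p\<^sub>0 w v q\<^sub>0}"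
proof -
  from L obtain P :: "(nat, 'a) productions" and S where
    P: "finite P" "L = generated_language P S"
    unfolding context_free_def by auto
  define P' where "P' = {((p, N, q), \<beta>). p \<in> Q \<and> (\<exists>\<alpha>. (N, \<alpha>) \<in> P \<and> lift_run Q \<Delta> p \<alpha> \<beta> q)}"
  have "P' \<subseteq> (\<Union>p\<in>Q. \<Union>(N, \<alpha>)\<in>P. (\<lambda>(\<beta>, q). ((p, N, q), \<beta>)) ` {(\<beta>, q). lift_run Q \<Delta> p \<alpha> \<beta> q})"
    by (force simp: P'_def)
  then have "finite P'"
    by (rule finite_subset) (use Q P finite_lift_run[OF Q(1) \<Delta>(2)] in auto)
  have complete: "\<exists>\<beta>. lift_run Q \<Delta> p \<alpha> \<beta> q \<and> yields P' \<beta> v"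
    if "yields P \<alpha> w" "run \<Delta> p w v q" "p \<in> Q" for \<alpha> w p v q
    using that
  proof (induction arbitrary: p v q)
    case yields_Nil
    then show ?case by (auto elim!: run_NilE intro: lift_Nil yields.yields_Nil)
  next
    case (yields_Terminal \<alpha> w a)
    from yields_Terminal.prems(1) obtain x y r where
      *: "(p, a, x, r) \<in> \<Delta>" "run \<Delta> r w y q" "v = x @ y"
      by (auto elim: run_ConsE)
    then obtain \<beta> where "lift_run Q \<Delta> r \<alpha> \<beta> q" "yields P' \<beta> y"
      using yields_Terminal.IH \<Delta>(1) by blast
    with * show ?case
      by (intro exI[of _ "map Terminal x @ \<beta>"]) (auto intro: lift_Terminal yields_appendI)
  next
    case (yields_Nonterminal N \<beta> u \<alpha> w)
    from yields_Nonterminal.prems(1) obtain x y r where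
      *: "run \<Delta> p u x r" "run \<Delta> r w y q" "v = x @ y"
      by (auto simp: run_append_iff)
    have r: "r \<in> Q" using *(1) yields_Nonterminal.prems(2) \<Delta>(1) by (rule run_in_states)
    obtain \<gamma> where "lift_run Q \<Delta> p \<beta> \<gamma> r" "yields P' \<gamma> x"
      using yields_Nonterminal.IH(1)[OF *(1)] yields_Nonterminal.prems(2) by blast
    moreover obtain \<delta> where "lift_run Q \<Delta> r \<alpha> \<delta> q" "yields P' \<delta> y"
      using yields_Nonterminal.IH(2)[OF *(2) r] by blast
    moreover have "((p, N, r), \<gamma>) \<in> P'"
      using calculation yields_Nonterminal by (auto simp: P'_def)
    ultimately show ?case
      using * r by (intro exI[of _ "Nonterminal (p, N, r) # \<delta>"])
        (auto intro: lift_Nonterminal yields.yields_Nonterminal)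
  qed
  \<comment> \<open>With a triple interpreted by the outputs of its runs, soundness becomes an
    instance of \<open>yields_in_interp\<close>: a lift records how to assemble one input word and
    one run from those of its symbols.\<close>
  define I where "I = (\<lambda>(p, N, q). {v. \<exists>w. yields P [Nonterminal N] w \<and> run \<Delta> p w v q})"
  have "\<exists>w. yields P \<alpha> w \<and> run \<Delta> p w v q" if "lift_run Q \<Delta> p \<alpha> \<beta> q" "v \<in> interp I \<beta>" for p \<alpha> \<beta> q v
    using that
  proof (induction arbitrary: v)
    case (lift_Terminal p a x q \<alpha> \<beta> r)
    then show ?case
      by (auto simp: interp_append) (metis run_Cons yields_Terminal)
  next
    case (lift_Nonterminal q \<alpha> \<beta> r p N)
    then obtain x y w where "v = x @ y" "y \<in> interp I \<beta>" "yields P [Nonterminal N] w" "run \<Delta> p w x q"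
      by (auto simp: I_def)
    moreover from this lift_Nonterminal.IH obtain w' where "yields P \<alpha> w'" "run \<Delta> q w' y r" by blast
    ultimately show ?case
      using yields_appendI[of P "[Nonterminal N]" w \<alpha> w']
      by (intro exI[of _ "w @ w'"]) (auto simp: run_append_iff)
  qed (auto intro: run_Nil yields_Nil)
  then have "interp I \<beta> \<subseteq> I N" if "(N, \<beta>) \<in> P'" for N \<beta>
    using that by (fastforce simp: P'_def I_def yields_single)
  from yields_in_interp[where I = I, OF _ this]
  have "\<exists>w\<in>L. run \<Delta> p\<^sub>0 w v q\<^sub>0" if "yields P' [Nonterminal (p\<^sub>0, S, q\<^sub>0)] v" for v
    using that by (fastforce simp: I_def P generated_language_eq)
  moreover have "yields P' [Nonterminal (p\<^sub>0, S, q\<^sub>0)] v" if "w \<in> L" "run \<Delta> p\<^sub>0 w v q\<^sub>0" for w v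
    using complete[of "[Nonterminal S]" w p\<^sub>0 v q\<^sub>0] that Q P
    by (auto simp: generated_language_eq elim!: lift_NonterminalE lift_NilE)
  ultimately have "{v. \<exists>w\<in>L. run \<Delta> p\<^sub>0 w v q\<^sub>0} = generated_language P' (p\<^sub>0, S, q\<^sub>0)"
    by (auto simp: generated_language_eq)
  with context_free_generated_language[OF \<open>finite P'\<close>] show ?thesis by simp
qed

text \<open>The transducer has states \<open>0\<close> to \<open>n\<close>. It applies
  \<open>h\<close> in state \<open>0\<close>, reads the pattern \<open>t\<close> letter by letter
  while emitting \<open>s\<close> at the first letter, and applies \<open>h\<close> again in state
  \<open>n\<close>. This extracts the right-hand sides of the product grammar from the tables of the
  factors.\<close>

lemma context_free_rewrite:
  fixes L :: "'a list set" and h :: "'a \<Rightarrow> 'b list"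
  assumes L: "context_free L" and "t \<noteq> []"
  shows "context_free {concat (map h x) @ s @ concat (map h y) |x y.
           x \<in> lists X \<and> y \<in> lists Y \<and> x @ t @ y \<in> L}"
proof -
  define n where "n = length t"
  define \<Delta> where "\<Delta> = {(0, a, h a, 0) |a. a \<in> X} \<union> {(n, a, h a, n) |a. a \<in> Y} \<union>
    {(i, t ! i, if i = 0 then s else [], Suc i) |i. i < n}"
  \<comment> \<open>A nonempty pattern keeps the two looping states apart and supplies the
    transition that emits \<open>s\<close>.\<close>
  have "n > 0" using \<open>t \<noteq> []\<close> by (simp add: n_def)
  have loop: "run \<Delta> i x (concat (map h x)) i" if "x \<in> lists Z" "\<And>a. a \<in> Z \<Longrightarrow> (i, a, h a, i) \<in> \<Delta>" for i x Z
    using that by (induction x) (auto intro: run.intros)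
  have chain: "run \<Delta> i (drop i t) [] n" if "0 < i" "i \<le> n" for i
    using that(2,1)
  proof (induction rule: inc_induct)
    case (step i)
    then have "(i, t ! i, [], Suc i) \<in> \<Delta>" by (auto simp: \<Delta>_def)
    with step show ?case
      using run_Cons[of i "t ! i" "[]" "Suc i" \<Delta> "drop (Suc i) t" "[]" n]
      by (simp add: Cons_nth_drop_Suc n_def)
  qed (simp add: n_def run_Nil)
  have "run \<Delta> 0 t s n"
  proof -
    have "(0, t ! 0, s, 1) \<in> \<Delta>" using \<open>n > 0\<close> by (force simp: \<Delta>_def)
    from run_Cons[OF this chain] \<open>n > 0\<close> show ?thesis
      by (simp add: Cons_nth_drop_Suc[of 0 t, simplified] n_def Suc_le_eq)
  qed
  moreover have "run \<Delta> 0 x (concat (map h x)) 0" if "x \<in> lists X" for x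
    using that by (rule loop) (simp add: \<Delta>_def)
  moreover have "run \<Delta> n y (concat (map h y)) n" if "y \<in> lists Y" for y
    using that by (rule loop) (simp add: \<Delta>_def)
  ultimately have "run \<Delta> 0 (x @ t @ y) (concat (map h x) @ s @ concat (map h y)) n"
    if "x \<in> lists X" "y \<in> lists Y" for x y
    using that unfolding run_append_iff by blast
  moreover have "\<exists>x y. x \<in> lists X \<and> y \<in> lists Y \<and> w = x @ t @ y \<and>
      v = concat (map h x) @ s @ concat (map h y)" if run: "run \<Delta> 0 w v n" for w v
  proof -
    \<comment> \<open>A run that has entered the chain must finish reading \<open>t\<close>,
      silently, before it can loop in state \<open>n\<close>.\<close>
    have *: "\<exists>y. y \<in> lists Y \<and> w = drop i t @ y \<and> v = concat (map h y)"
      if "run \<Delta> i w v r" "0 < i" "i \<le> n" "r = n" for i r w v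
      using that
    proof induction
      case (run_Nil p)
      then show ?case by (auto simp: n_def)
    next
      case (run_Cons p a z q w v r)
      from run_Cons(1) \<open>0 < p\<close> consider "p = n" "q = n" "z = h a" "a \<in> Y"
        | "p < n" "a = t ! p" "z = []" "q = Suc p" by (auto simp: \<Delta>_def)
      then show ?case
      proof cases
        case 1
        with run_Cons obtain y where "y \<in> lists Y" "w = drop n t @ y" "v = concat (map h y)" by auto
        with 1 show ?thesis by (intro exI[of _ "a # y"]) (auto simp: n_def)
      next
        case 2
        with run_Cons obtain y where "y \<in> lists Y" "w = drop q t @ y" "v = concat (map h y)" by auto
        with 2 show ?thesis
          by (intro exI[of _ y]) (auto simp: n_def Cons_nth_drop_Suc[symmetric])
      qed
    qed
    have "p = 0 \<Longrightarrow> \<exists>x y. x \<in> lists X \<and> y \<in> lists Y \<and> w = x @ t @ y \<and>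
        v = concat (map h x) @ s @ concat (map h y)" if "run \<Delta> p w v r" "r = n" for p r w v
      using that
    proof induction
      case (run_Nil p)
      with \<open>n > 0\<close> show ?case by simp
    next
      case (run_Cons p a z q w v r)
      from run_Cons(1) \<open>p = 0\<close> \<open>n > 0\<close> consider "q = 0" "z = h a" "a \<in> X"
        | "a = t ! 0" "z = s" "q = 1" by (auto simp: \<Delta>_def)
      then show ?case
      proof cases
        case 1
        with run_Cons obtain x y where "x \<in> lists X" "y \<in> lists Y" "w = x @ t @ y"
          "v = concat (map h x) @ s @ concat (map h y)" by auto
        with 1 show ?thesis by (intro exI[of _ "a # x"] exI[of _ y]) auto
      next
        case 2
        with run_Cons * [of 1 w v n] \<open>n > 0\<close> obtain y where
          "y \<in> lists Y" "w = drop 1 t @ y" "v = concat (map h y)" by auto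
        with 2 \<open>n > 0\<close> show ?thesis
          by (intro exI[of _ "[]"] exI[of _ y])
            (auto simp: n_def Cons_nth_drop_Suc[of 0 t, simplified])
      qed
    qed
    with run show ?thesis by blast
  qed
  ultimately have "{concat (map h x) @ s @ concat (map h y) |x y.
      x \<in> lists X \<and> y \<in> lists Y \<and> x @ t @ y \<in> L} = {v. \<exists>w\<in>L. run \<Delta> 0 w v n}"
    by blast
  moreover have "context_free {v. \<exists>w\<in>L. run \<Delta> 0 w v n}"
  proof (rule context_free_transduction[OF L, of "{..n}"])
    fix p a
    have "{(x, q). (p, a, x, q) \<in> \<Delta>} \<subseteq> {(h a, p), (s, Suc p), ([], Suc p)}"
      by (auto simp: \<Delta>_def)
    then show "finite {(x, q). (p, a, x, q) \<in> \<Delta>}" by (rule finite_subset) simp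
  qed (auto simp: \<Delta>_def)
  ultimately show ?thesis by simp
qed

section \<open>Regular languages\<close>

text \<open>An automaton is transported along \<open>to_nat\<close>, so that states may be pairs or
  options. The set \<open>F\<close> is arbitrary; the proof cuts it down to
  \<open>Q\<close>.\<close>

lemma regular_languageI:
  fixes Q :: "'s::countable set"
  assumes "finite Q" "q\<^sub>0 \<in> Q" and \<delta>: "\<And>q a. q \<in> Q \<Longrightarrow> a \<in> A \<Longrightarrow> \<delta> q a \<in> Q"
  shows "regular_language A {w \<in> lists A. foldl \<delta> q\<^sub>0 w \<in> F}"
proof -
  define \<delta>' where "\<delta>' n a = to_nat (\<delta> (from_nat n) a)" for n a
  have fold: "foldl \<delta>' (to_nat q) w = to_nat (foldl \<delta> q w)" for q w
    by (induction w arbitrary: q) (auto simp: \<delta>'_def)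
  have Q: "foldl \<delta> q w \<in> Q" if "w \<in> lists A" "q \<in> Q" for w q
    using that by (induction w arbitrary: q) (auto simp: \<delta>)
  show ?thesis
    unfolding regular_language_def
    by (intro exI[of _ "to_nat ` Q"] exI[of _ \<delta>'] exI[of _ "to_nat q\<^sub>0"] exI[of _ "to_nat ` (F \<inter> Q)"])
      (use assms Q[OF _ \<open>q\<^sub>0 \<in> Q\<close>] in \<open>auto simp: fold \<delta>'_def inj_image_mem_iff[OF inj_to_nat]\<close>)
qed

text \<open>The automaton runs in parallel with a counter that holds the length of the input while
  this is a prefix of \<open>e\<close>, and \<open>None\<close> afterwards. The counter shows
  \<open>Some (length e)\<close> exactly on the input \<open>e\<close>.\<close>

lemma regular_language_remove:
  assumes "regular_language A L"
  shows "regular_language A (L - {e})"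
proof -
  from assms obtain Q :: "nat set" and \<delta> q\<^sub>0 F where Q: "finite Q" "q\<^sub>0 \<in> Q"
    "\<And>q a. q \<in> Q \<Longrightarrow> a \<in> A \<Longrightarrow> \<delta> q a \<in> Q" and L: "L = {w \<in> lists A. foldl \<delta> q\<^sub>0 w \<in> F}"
    unfolding regular_language_def by blast
  define \<delta>' where "\<delta>' = (\<lambda>(q, s) a. (\<delta> q a,
    case s of Some k \<Rightarrow> if k < length e \<and> e ! k = a then Some (Suc k) else None | None \<Rightarrow> None))"
  have fold: "foldl \<delta>' (q\<^sub>0, Some 0) w =
      (foldl \<delta> q\<^sub>0 w, if \<exists>t. e = w @ t then Some (length w) else None)" for w
  proof (induction w rule: rev_induct)
    case (snoc a w)
    have "(\<exists>t. e = w @ t) \<and> length w < length e \<and> e ! length w = a \<longleftrightarrow> (\<exists>t. e = w @ a # t)"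
    proof
      assume *: "(\<exists>t. e = w @ t) \<and> length w < length e \<and> e ! length w = a"
      then obtain t where "e = w @ t" by auto
      with * show "\<exists>t. e = w @ a # t" by (cases t) auto
    qed auto
    with snoc show ?case by (auto simp: \<delta>'_def)
  qed (simp add: \<delta>'_def)
  have "regular_language A {w \<in> lists A. foldl \<delta>' (q\<^sub>0, Some 0) w \<in> F \<times> (- {Some (length e)})}"
    by (rule regular_languageI[of "Q \<times> insert None (Some ` {..length e})"])
      (use Q in \<open>auto simp: \<delta>'_def split: option.splits\<close>)
  also have "{w \<in> lists A. foldl \<delta>' (q\<^sub>0, Some 0) w \<in> F \<times> (- {Some (length e)})} = L - {e}"
    by (auto simp: fold L)
  finally show ?thesis .
qed

section \<open>Alternating sequences of blocks\<close>

text \<open>One notion covers sequences of combing words, of monoid elements and of congruence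
  classes. With identities removed from both sets it describes the normal forms in a free
  product.\<close>

definition alternating :: "(bool \<Rightarrow> 'b set) \<Rightarrow> (bool \<times> 'b) list set" where
  "alternating B = {bs. distinct_adj (map fst bs) \<and> (\<forall>(i, x)\<in>set bs. x \<in> B i)}"

lemma alternating_Nil [simp]: "[] \<in> alternating B"
  by (simp add: alternating_def)

lemma alternating_append:
  "bs @ cs \<in> alternating B \<longleftrightarrow> bs \<in> alternating B \<and> cs \<in> alternating B \<and>
     (bs = [] \<or> cs = [] \<or> fst (last bs) \<noteq> fst (hd cs))"
  by (auto simp: alternating_def distinct_adj_append_iff last_map hd_map)

lemma alternating_Cons:
  "(i, x) # bs \<in> alternating B \<longleftrightarrow> x \<in> B i \<and> bs \<in> alternating B \<and> (bs = [] \<or> fst (hd bs) \<noteq> i)"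
  by (auto simp: alternating_def distinct_adj_Cons hd_map)

lemma alternating_last: "bs \<in> alternating B \<Longrightarrow> bs \<noteq> [] \<Longrightarrow> snd (last bs) \<in> B (fst (last bs))"
  by (cases bs rule: rev_cases) (auto simp: alternating_append alternating_Cons)

text \<open>Disjoint copies of both alphabets inside the natural numbers: parity names the factor
  and halving recovers the letter.\<close>

definition tagged :: "bool \<Rightarrow> nat \<Rightarrow> nat" where
  "tagged i a = 2 * a + of_bool i"

lemma tagged [simp]: "odd (tagged i a) = i" "even (tagged i a) = (\<not> i)" "tagged i a div 2 = a"
  by (auto simp: tagged_def)

definition block_word :: "(bool \<times> nat list) list \<Rightarrow> nat list" where
  "block_word bs = concat (map (\<lambda>(i, x). map (tagged i) x) bs)"

lemma block_word_simps [simp]: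
  "block_word [] = []" "block_word ((i, x) # bs) = map (tagged i) x @ block_word bs"
  "block_word (bs @ cs) = block_word bs @ block_word cs"
  by (simp_all add: block_word_def)

lemma block_word_in_lists:
  assumes "bs \<in> alternating B" "\<And>i. B i \<subseteq> lists (A i)"
  shows "block_word bs \<in> lists (\<Union>i. tagged i ` A i)"
  using assms(1)
proof (induction bs)
  case (Cons b bs)
  obtain i x where [simp]: "b = (i, x)" by fastforce
  from Cons have "x \<in> B i" "block_word bs \<in> lists (\<Union>i. tagged i ` A i)"
    by (auto simp: alternating_Cons)
  moreover from \<open>x \<in> B i\<close> assms(2)[of i] have "map (tagged i) x \<in> lists (\<Union>i. tagged i ` A i)"
    by (fastforce simp: in_lists_conv_set)
  ultimately show ?case by simp
qed simp

text \<open>As no block is empty, block boundaries are exactly the changes of parity. In the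
  automaton, \<open>None\<close> is the initial state, \<open>Some None\<close> the sink, and
  \<open>Some (Some (i, q))\<close> means that the current block belongs to factor \<open>i\<close>
  and has led its automaton to \<open>q\<close>; a change of parity is allowed only if
  \<open>q\<close> is final.\<close>

lemma regular_language_alternating:
  assumes B: "\<And>i. regular_language (A i) (B i)" and Nil: "\<And>i. [] \<notin> B i"
  shows "regular_language (\<Union>i. tagged i ` A i) (block_word ` alternating B)"
proof -
  define dfa where "dfa i Q \<delta> q F \<longleftrightarrow> finite Q \<and> q \<in> Q \<and> (\<forall>q\<in>Q. \<forall>a\<in>A i. \<delta> q a \<in> Q) \<and>
      B i = {w \<in> lists (A i). foldl \<delta> q w \<in> F}"
    for i and Q :: "nat set" and \<delta> :: "nat \<Rightarrow> nat \<Rightarrow> nat" and q F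
  have "\<exists>Q \<delta> q F. dfa i Q \<delta> q F" for i
    using B[of i] unfolding regular_language_def dfa_def by blast
  then obtain Q \<delta> q\<^sub>0 F where "\<And>i. dfa i (Q i) (\<delta> i) (q\<^sub>0 i) (F i)"
    by metis
  then have Q: "finite (Q i)" "q\<^sub>0 i \<in> Q i" "\<And>q a. q \<in> Q i \<Longrightarrow> a \<in> A i \<Longrightarrow> \<delta> i q a \<in> Q i"
    and F: "B i = {w \<in> lists (A i). foldl (\<delta> i) (q\<^sub>0 i) w \<in> F i}" for i
    by (auto simp: dfa_def)
  define start where "start a = Some (Some (odd a, \<delta> (odd a) (q\<^sub>0 (odd a)) (a div 2)))" for a
  define \<delta>' where "\<delta>' s a = (case s of None \<Rightarrow> start a | Some None \<Rightarrow> Some None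
      | Some (Some (i, q)) \<Rightarrow> if odd a = i then Some (Some (i, \<delta> i q (a div 2)))
          else if q \<in> F i then start a else Some None)" for s and a :: nat
  have step_simps: "\<delta>' None a = start a" "\<delta>' (Some None) a = Some None"
    "\<delta>' (Some (Some (i, q))) a = (if odd a = i then Some (Some (i, \<delta> i q (a div 2)))
       else if q \<in> F i then start a else Some None)" for a i q
    by (simp_all add: \<delta>'_def)
  let ?A = "\<Union>i. tagged i ` A i"
  let ?Q = "insert None (insert (Some None) (Some ` Some ` Sigma UNIV Q))"
  let ?F = "insert None {Some (Some (i, q)) |i q. q \<in> F i}"
  \<comment> \<open>The last block \<open>x\<close> is nonempty but possibly unfinished, hence not
    yet required to lie in \<open>B i\<close>; only its state is known.\<close>
  let ?inv = "\<lambda>w i q. \<exists>bs x. w = block_word bs @ map (tagged i) x \<and> x \<noteq> [] \<and> x \<in> lists (A i) \<and>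
      q = foldl (\<delta> i) (q\<^sub>0 i) x \<and> bs \<in> alternating B \<and> (bs = [] \<or> fst (last bs) \<noteq> i)"
  have inv: "(foldl \<delta>' None w = None \<longrightarrow> w = []) \<and>
      (\<forall>i q. foldl \<delta>' None w = Some (Some (i, q)) \<longrightarrow> ?inv w i q)" if "w \<in> lists ?A" for w
    using that
  proof (induction w rule: rev_induct)
    case (snoc a w)
    then obtain j b where a: "a = tagged j b" "b \<in> A j" by auto
    let ?s = "foldl \<delta>' None w"
    show ?case
    proof (intro conjI allI impI)
      show "w @ [a] = []" if "foldl \<delta>' None (w @ [a]) = None"
        using that by (auto simp: \<delta>'_def start_def split: option.splits if_splits)
      fix i q assume step: "foldl \<delta>' None (w @ [a]) = Some (Some (i, q))"
      then consider (new) "?s = None" | (same) p where "?s = Some (Some (i, p))" "j = i"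
        | (switch) k p where "?s = Some (Some (k, p))" "j \<noteq> k" "p \<in> F k"
        using a by (cases ?s rule: option.exhaust; cases "the ?s" rule: option.exhaust)
          (auto simp: step_simps start_def split: if_splits)
      then show "?inv (w @ [a]) i q"
      proof cases
        case new
        with snoc step a show ?thesis
          by (intro exI[of _ "[]"] exI[of _ "[b]"]) (auto simp: step_simps start_def)
      next
        case same
        with snoc obtain bs x where "w = block_word bs @ map (tagged i) x" "x \<in> lists (A i)"
          "p = foldl (\<delta> i) (q\<^sub>0 i) x" "bs \<in> alternating B" "bs = [] \<or> fst (last bs) \<noteq> i"
          by auto
        with step a same show ?thesis
          by (intro exI[of _ bs] exI[of _ "x @ [b]"]) (auto simp: step_simps)
      next
        case switch
        with snoc obtain bs x where w: "w = block_word bs @ map (tagged k) x" "x \<in> lists (A k)"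
          "p = foldl (\<delta> k) (q\<^sub>0 k) x" "bs \<in> alternating B" "bs = [] \<or> fst (last bs) \<noteq> k"
          by auto
        with switch have "bs @ [(k, x)] \<in> alternating B"
          by (auto simp: alternating_append alternating_Cons F)
        with w step a switch show ?thesis
          by (intro exI[of _ "bs @ [(k, x)]"] exI[of _ "[b]"]) (auto simp: step_simps start_def)
      qed
    qed
  qed simp
  have same_tag: "foldl \<delta>' (Some (Some (i, q))) (map (tagged i) x) = Some (Some (i, foldl (\<delta> i) q x))"
    for i q x
    by (induction x arbitrary: q) (auto simp: step_simps)
  \<comment> \<open>In the converse direction the blocks are read one by one: the first letter of a
    block, present by \<open>Nil\<close>, leaves the accepted previous block and the rest stays in
    the same automaton.\<close>
  have final: "foldl \<delta>' None (block_word bs) =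
      (if bs = [] then None else case last bs of (i, x) \<Rightarrow> Some (Some (i, foldl (\<delta> i) (q\<^sub>0 i) x)))"
    if "bs \<in> alternating B" for bs
    using that
  proof (induction bs rule: rev_induct)
    case (snoc b bs)
    obtain i x where b: "b = (i, x)" by fastforce
    with snoc.prems Nil[of i] obtain a y where x: "x = a # y" "x \<in> B i"
      by (cases x) (auto simp: alternating_append alternating_Cons)
    have "foldl \<delta>' None (block_word bs @ [tagged i a]) = Some (Some (i, \<delta> i (q\<^sub>0 i) a))"
    proof (cases "bs = []")
      case True
      then show ?thesis by (simp add: step_simps start_def)
    next
      case False
      with snoc.prems b have "fst (last bs) \<noteq> i" "bs \<in> alternating B"
        by (auto simp: alternating_append)
      moreover obtain j y where "last bs = (j, y)" by fastforce
      moreover from calculation False alternating_last[of bs B] F[of j]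
      have "foldl (\<delta> j) (q\<^sub>0 j) y \<in> F j" by simp
      ultimately show ?thesis using snoc.IH False
        by (simp add: step_simps start_def)
    qed
    with b x same_tag show ?case by simp
  qed simp
  have "regular_language ?A {w \<in> lists ?A. foldl \<delta>' None w \<in> ?F}"
    by (rule regular_languageI[of ?Q]) (use Q in \<open>auto simp: \<delta>'_def start_def split: option.splits\<close>)
  also have "{w \<in> lists ?A. foldl \<delta>' None w \<in> ?F} = block_word ` alternating B"
  proof (intro equalityI subsetI)
    fix w assume "w \<in> {w \<in> lists ?A. foldl \<delta>' None w \<in> ?F}"
    then consider "w = []" | i q where "?inv w i q" "q \<in> F i" using inv[of w] by auto
    then show "w \<in> block_word ` alternating B"
    proof cases
      case 1
      then show ?thesis by (intro image_eqI[of _ _ "[]"]) auto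
    next
      case 2
      then obtain bs x where "w = block_word (bs @ [(i, x)])" "bs @ [(i, x)] \<in> alternating B"
        by (auto simp: alternating_append alternating_Cons F)
      then show ?thesis by blast
    qed
  next
    fix w assume "w \<in> block_word ` alternating B"
    then obtain bs where bs: "bs \<in> alternating B" "w = block_word bs" by auto
    then have "w \<in> lists ?A" using block_word_in_lists[of bs B A] F by blast
    moreover have "bs \<noteq> [] \<Longrightarrow> snd (last bs) \<in> B (fst (last bs))"
      using bs alternating_last by blast
    ultimately show "w \<in> {w \<in> lists ?A. foldl \<delta>' None w \<in> ?F}"
      using bs final F by (auto split: prod.splits)
  qed
  finally show ?thesis .
qed

section \<open>Restriction of the three parts to a regular language\<close>

abbreviation marked_product :: "'a list \<Rightarrow> 'a list \<Rightarrow> 'a list \<Rightarrow> 'a marked list" where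
  "marked_product u v w \<equiv> map Letter u @ [Hash1] @ map Letter v @ [Hash2] @ map Letter (rev w)"

text \<open>A transducer that copies its input and has a run only on marked products over
  \<open>R\<close> realizes the intersection.\<close>

lemma context_free_restrict_regular:
  assumes L: "context_free L" and R: "regular_language A R"
  shows "context_free {marked_product u v w |u v w. u \<in> R \<and> v \<in> R \<and> w \<in> R \<and> marked_product u v w \<in> L}"
proof -
  from R obtain Q :: "nat set" and \<delta> q\<^sub>0 F where Q: "finite Q" "q\<^sub>0 \<in> Q" "F \<subseteq> Q"
    "\<And>q a. q \<in> Q \<Longrightarrow> a \<in> A \<Longrightarrow> \<delta> q a \<in> Q" and R: "R = {w \<in> lists A. foldl \<delta> q\<^sub>0 w \<in> F}"
    unfolding regular_language_def by blast
  \<comment> \<open>The first component of a state counts the markers passed. The third word is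
    written in reverse, so after \<open>Hash2\<close> the automaton starts in a guessed final state
    \<open>f\<close> and is run backwards to the initial state.\<close>
  define \<Delta> where "\<Delta> = {((k, q), Letter a, [Letter a], (k, \<delta> q a)) |k q a. k < 2 \<and> q \<in> Q \<and> a \<in> A}
    \<union> {((0, q), Hash1, [Hash1], (1, q\<^sub>0)) |q. q \<in> F}
    \<union> {((1, q), Hash2, [Hash2], (2, f)) |q f. q \<in> F \<and> f \<in> F}
    \<union> {((2, \<delta> q a), Letter a, [Letter a], (2 :: nat, q)) |q a. q \<in> Q \<and> a \<in> A}"
  have forward: "run \<Delta> (k, q) (map Letter w) (map Letter w) (k, foldl \<delta> q w)"
    if "w \<in> lists A" "q \<in> Q" "k < 2" for k q w
    using that
  proof (induction w arbitrary: q)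
    case (Cons a w)
    then have "((k, q), Letter a, [Letter a], (k, \<delta> q a)) \<in> \<Delta>" by (auto simp: \<Delta>_def)
    with Cons Q show ?case using run_Cons[of "(k, q)" "Letter a" "[Letter a]"] by auto
  qed (simp add: run_Nil)
  have fold_Q: "foldl \<delta> q\<^sub>0 w \<in> Q" if "w \<in> lists A" for w
    using that by (induction w rule: rev_induct) (auto simp: Q)
  have backward: "run \<Delta> (2, foldl \<delta> q\<^sub>0 w) (map Letter (rev w)) (map Letter (rev w)) (2, q\<^sub>0)"
    if "w \<in> lists A" for w
    using that
  proof (induction w rule: rev_induct)
    case (snoc a w)
    then have "((2, \<delta> (foldl \<delta> q\<^sub>0 w) a), Letter a, [Letter a], (2, foldl \<delta> q\<^sub>0 w)) \<in> \<Delta>"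
      using fold_Q[of w] by (auto simp: \<Delta>_def)
    with snoc show ?case using run_Cons[of "(2, \<delta> (foldl \<delta> q\<^sub>0 w) a)" "Letter a" "[Letter a]"] by auto
  qed (simp add: run_Nil)
  have complete: "run \<Delta> (0, q\<^sub>0) (marked_product u v w) (marked_product u v w) (2, q\<^sub>0)"
    if "u \<in> R" "v \<in> R" "w \<in> R" for u v w
  proof -
    have "run \<Delta> (0, foldl \<delta> q\<^sub>0 u) [Hash1] [Hash1] (1, q\<^sub>0)"
      using that run_Cons[OF _ run_Nil, of _ Hash1 "[Hash1]" _ \<Delta>] by (auto simp: \<Delta>_def R)
    moreover have "run \<Delta> (1, foldl \<delta> q\<^sub>0 v) [Hash2] [Hash2] (2, foldl \<delta> q\<^sub>0 w)"
      using that run_Cons[OF _ run_Nil, of _ Hash2 "[Hash2]" _ \<Delta>] by (auto simp: \<Delta>_def R)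
    ultimately show ?thesis
      using that Q by (intro run_append) (auto simp: R intro: forward backward)
  qed
  have phase2: "\<exists>w\<in>lists A. x = map Letter (rev w) \<and> y = x \<and> f = foldl \<delta> q\<^sub>0 w"
    if "run \<Delta> p x y r" "p = (2, f)" "r = (2, q\<^sub>0)" for p x y r f
    using that
  proof (induction arbitrary: f)
    case (run_Cons p c z q x y r)
    then obtain a q' where *: "c = Letter a" "z = [c]" "q = (2, q')" "a \<in> A" "f = \<delta> q' a"
      by (auto simp: \<Delta>_def)
    with run_Cons obtain w where "w \<in> lists A" "x = map Letter (rev w)" "y = x" "q' = foldl \<delta> q\<^sub>0 w"
      by auto
    with * show ?case by (intro bexI[of _ "w @ [a]"]) auto
  qed auto
  have phase1: "\<exists>v\<in>lists A. \<exists>w\<in>R. x = map Letter v @ [Hash2] @ map Letter (rev w) \<and> y = x \<and> foldl \<delta> q v \<in> F"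
    if "run \<Delta> p x y r" "p = (1, q)" "r = (2, q\<^sub>0)" for p x y r q
    using that
  proof (induction arbitrary: q)
    case (run_Cons p c z q' x y r)
    then consider a where "c = Letter a" "z = [c]" "a \<in> A" "q' = (1, \<delta> q a)"
      | f where "c = Hash2" "z = [c]" "q' = (2, f)" "f \<in> F" "q \<in> F"
      by (auto simp: \<Delta>_def)
    then show ?case
    proof cases
      case 1
      with run_Cons obtain v w where "v \<in> lists A" "w \<in> R"
        "x = map Letter v @ [Hash2] @ map Letter (rev w)" "y = x" "foldl \<delta> (\<delta> q a) v \<in> F"
        by blast
      with 1 show ?thesis by (intro bexI[of _ "a # v"] bexI[of _ w]) auto
    next
      case 2
      with run_Cons phase2[of q' x y r f] obtain w where
        "w \<in> lists A" "x = map Letter (rev w)" "y = x" "f = foldl \<delta> q\<^sub>0 w"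
        by auto
      with 2 show ?thesis by (intro bexI[of _ "[]"] bexI[of _ w]) (auto simp: R)
    qed
  qed auto
  have phase0: "\<exists>u\<in>lists A. \<exists>v\<in>R. \<exists>w\<in>R. x = marked_product u v w \<and> y = x \<and> foldl \<delta> q u \<in> F"
    if "run \<Delta> p x y r" "p = (0, q)" "r = (2, q\<^sub>0)" for p x y r q
    using that
  proof (induction arbitrary: q)
    case (run_Cons p c z q' x y r)
    then consider a where "c = Letter a" "z = [c]" "a \<in> A" "q' = (0, \<delta> q a)"
      | "c = Hash1" "z = [c]" "q' = (1, q\<^sub>0)" "q \<in> F"
      by (auto simp: \<Delta>_def)
    then show ?case
    proof cases
      case 1
      with run_Cons obtain u v w where "u \<in> lists A" "v \<in> R" "w \<in> R"
        "x = marked_product u v w" "y = x" "foldl \<delta> (\<delta> q a) u \<in> F"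
        by blast
      with 1 show ?thesis by (intro bexI[of _ "a # u"] bexI[of _ v] bexI[of _ w]) auto
    next
      case 2
      with run_Cons phase1[of q' x y r q\<^sub>0] obtain v w where "v \<in> lists A" "w \<in> R"
        "x = map Letter v @ [Hash2] @ map Letter (rev w)" "y = x" "foldl \<delta> q\<^sub>0 v \<in> F"
        by auto
      with 2 show ?thesis by (intro bexI[of _ "[]"] bexI[of _ v] bexI[of _ w]) (auto simp: R)
    qed
  qed auto
  have "{marked_product u v w |u v w. u \<in> R \<and> v \<in> R \<and> w \<in> R \<and> marked_product u v w \<in> L} =
      {y. \<exists>x\<in>L. run \<Delta> (0, q\<^sub>0) x y (2, q\<^sub>0)}"
  proof (intro equalityI subsetI)
    fix y assume "y \<in> {y. \<exists>x\<in>L. run \<Delta> (0, q\<^sub>0) x y (2, q\<^sub>0)}"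
    then obtain x where x: "x \<in> L" "run \<Delta> (0, q\<^sub>0) x y (2, q\<^sub>0)" by auto
    from phase0[OF x(2) HOL.refl HOL.refl] x(1) show
      "y \<in> {marked_product u v w |u v w. u \<in> R \<and> v \<in> R \<and> w \<in> R \<and> marked_product u v w \<in> L}"
      by (auto simp: R)
  qed (use complete in blast)
  moreover have "context_free {y. \<exists>x\<in>L. run \<Delta> (0, q\<^sub>0) x y (2, q\<^sub>0)}"
  proof (rule context_free_transduction[OF L, of "{..2} \<times> Q"])
    fix p a
    have "{(x, q). (p, a, x, q) \<in> \<Delta>} \<subseteq> {[a]} \<times> {..2} \<times> Q"
      using Q by (auto simp: \<Delta>_def)
    then show "finite {(x, q). (p, a, x, q) \<in> \<Delta>}" by (rule finite_subset) (use Q in simp)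
  qed (use Q in \<open>auto simp: \<Delta>_def\<close>)
  ultimately show ?thesis by simp
qed

section \<open>Free products of monoids\<close>

definition seq_prod :: "('p, 'z) monoid_scheme \<Rightarrow> (bool \<times> 'p) list \<Rightarrow> 'p" where
  "seq_prod M s = foldr (\<lambda>(i, m) x. m \<otimes>\<^bsub>M\<^esub> x) s \<one>\<^bsub>M\<^esub>"

lemma seq_prod_simps [simp]:
  "seq_prod M [] = \<one>\<^bsub>M\<^esub>" "seq_prod M ((i, m) # s) = m \<otimes>\<^bsub>M\<^esub> seq_prod M s"
  by (simp_all add: seq_prod_def)

text \<open>An internal free product, given by the normal form theorem as an axiom. Both factors are
  submonoids of \<open>M\<close> and so share one type, whatever the types of the monoids they are
  isomorphic to.\<close>

locale free_factors = monoid M for M :: "('p, 'z) monoid_scheme" (structure) +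
  fixes N :: "bool \<Rightarrow> 'p set"
  assumes factor_subset: "N i \<subseteq> carrier M"
    and factor_one: "\<one> \<in> N i"
    and factor_mult: "x \<in> N i \<Longrightarrow> y \<in> N i \<Longrightarrow> x \<otimes> y \<in> N i"
    and normal_form_exists: "x \<in> carrier M \<Longrightarrow> \<exists>s\<in>alternating (\<lambda>i. N i - {\<one>}). seq_prod M s = x"
    and normal_form_unique: "s \<in> alternating (\<lambda>i. N i - {\<one>}) \<Longrightarrow>
      t \<in> alternating (\<lambda>i. N i - {\<one>}) \<Longrightarrow> seq_prod M s = seq_prod M t \<Longrightarrow> s = t"

lemma iso_inv_into:
  assumes "monoid G" "h \<in> iso G H"
  shows "inv_into (carrier G) h \<in> iso H G"
proof -
  interpret G: monoid G by fact
  from assms have h: "h \<in> hom G H" "bij_betw h (carrier G) (carrier H)"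
    by (auto simp: iso_def)
  let ?g = "inv_into (carrier G) h"
  have g: "bij_betw ?g (carrier H) (carrier G)" by (rule bij_betw_inv_into[OF h(2)])
  have "?g (x \<otimes>\<^bsub>H\<^esub> y) = ?g x \<otimes>\<^bsub>G\<^esub> ?g y" if "x \<in> carrier H" "y \<in> carrier H" for x y
  proof -
    have *: "?g x \<in> carrier G" "?g y \<in> carrier G" using g that by (auto simp: bij_betw_def)
    then have "h (?g x \<otimes>\<^bsub>G\<^esub> ?g y) = x \<otimes>\<^bsub>H\<^esub> y"
      using h that by (simp add: hom_mult f_inv_into_f bij_betw_def)
    with * h(2) show ?thesis by (metis bij_betw_inv_into_left G.m_closed)
  qed
  with g show ?thesis by (auto simp: iso_def hom_def bij_betw_def)
qed

text \<open>Replaces the quotient by a surjection from words with known kernel: the class map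
  followed by the inverse of the given isomorphism.\<close>

lemma presentation_map:
  assumes "has_presentation M A \<R>"
  obtains \<phi> where "\<phi> \<in> hom (free_monoid A) M" "\<phi> [] = \<one>\<^bsub>M\<^esub>" "\<phi> ` lists A = carrier M"
    "\<forall>u\<in>lists A. \<forall>v\<in>lists A. \<phi> u = \<phi> v \<longleftrightarrow> (u, v) \<in> presentation_congruence A \<R>"
proof -
  let ?P = "presented_monoid A \<R>" and ?C = "presentation_congruence A \<R>"
  from assms have M: "monoid M" and \<R>: "\<R> \<subseteq> lists A \<times> lists A" and "M \<cong> ?P"
    by (auto simp: has_presentation_def)
  interpret M: monoid M by fact
  interpret P: monoid ?P by (rule monoid_presented_monoid[OF \<R>])
  from \<open>M \<cong> ?P\<close> obtain g where "g \<in> iso M ?P" by (auto simp: is_iso_def)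
  then have f: "inv_into (carrier M) g \<in> iso ?P M" (is "?f \<in> _") by (rule iso_inv_into[OF M])
  then have hom: "?f \<in> hom ?P M" and bij: "bij_betw ?f (carrier ?P) (carrier M)"
    by (auto simp: iso_def)
  have eq: "equiv (lists A) ?C" by (rule equiv_presentation_congruence[OF \<R>])
  have carrier: "carrier ?P = (\<lambda>u. ?C `` {u}) ` lists A" "\<one>\<^bsub>?P\<^esub> = ?C `` {[]}"
    by (auto simp: presented_monoid_def quotient_def)
  \<comment> \<open>\<open>hom\<close> does not demand that identities be preserved. Surjectivity
    makes the image of the identity a left identity of \<open>M\<close>, hence the identity.\<close>
  have one: "?f \<one>\<^bsub>?P\<^esub> = \<one>\<^bsub>M\<^esub>"
  proof (rule M.one_unique)
    fix x assume "x \<in> carrier M"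
    with bij obtain y where "y \<in> carrier ?P" "x = ?f y" by (auto simp: bij_betw_def)
    with hom_mult[OF hom P.one_closed, of y] show "?f \<one>\<^bsub>?P\<^esub> \<otimes>\<^bsub>M\<^esub> x = x"
      by simp
  qed (rule hom_in_carrier[OF hom P.one_closed])
  show thesis
  proof (rule that[of "\<lambda>u. ?f (?C `` {u})"])
    show "(\<lambda>u. ?f (?C `` {u})) \<in> hom (free_monoid A) M"
    proof (rule homI)
      show "?f (?C `` {u}) \<in> carrier M" if "u \<in> carrier (free_monoid A)" for u
        using that hom carrier by (auto simp: free_monoid_def hom_def)
      show "?f (?C `` {u \<otimes>\<^bsub>free_monoid A\<^esub> v}) = ?f (?C `` {u}) \<otimes>\<^bsub>M\<^esub> ?f (?C `` {v})"
        if "u \<in> carrier (free_monoid A)" "v \<in> carrier (free_monoid A)" for u v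
      proof -
        from that have "u \<in> lists A" "v \<in> lists A" by (simp_all add: free_monoid_def)
        with presented_monoid_mult_class[OF \<R> this] show ?thesis
          using hom_mult[OF hom, of "?C `` {u}" "?C `` {v}"] carrier(1)
          by (simp add: free_monoid_def del: in_lists_conv_set)
      qed
    qed
    show "?f (?C `` {[]}) = \<one>\<^bsub>M\<^esub>" using one carrier by simp
    show "(\<lambda>u. ?f (?C `` {u})) ` lists A = carrier M"
      using bij carrier by (auto simp: bij_betw_def image_image)
    show "\<forall>u\<in>lists A. \<forall>v\<in>lists A. ?f (?C `` {u}) = ?f (?C `` {v}) \<longleftrightarrow> (u, v) \<in> ?C"
    proof (intro ballI)
      fix u v assume that: "u \<in> lists A" "v \<in> lists A"
      have "?f (?C `` {u}) = ?f (?C `` {v}) \<longleftrightarrow> ?C `` {u} = ?C `` {v}"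
        using bij that carrier(1) by (intro inj_on_eq_iff) (auto simp: bij_betw_def)
      then show "?f (?C `` {u}) = ?f (?C `` {v}) \<longleftrightarrow> (u, v) \<in> ?C"
        using eq_equiv_class_iff[OF eq that] by simp
    qed
  qed
qed

text \<open>Van der Waerden's argument: the two monoids act on reduced sequences, each by multiplying
  into the leading entry. The action of a word on the empty sequence recovers its normal form.\<close>

locale monoid_pair =
  fixes P :: "bool \<Rightarrow> ('c, 'e) monoid_scheme"
  assumes monoid_P: "monoid (P i)"
begin

abbreviation seqs :: "(bool \<times> 'c) list set" where
  "seqs \<equiv> alternating (\<lambda>i. carrier (P i) - {\<one>\<^bsub>P i\<^esub>})"

text \<open>With the identity as default entry, every reduced sequence splits into an element of
  factor \<open>i\<close> and a remainder not starting in that factor; \<open>push\<close> reverses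
  the splitting.\<close>

definition leading :: "bool \<Rightarrow> (bool \<times> 'c) list \<Rightarrow> 'c" where
  "leading i s = (if s \<noteq> [] \<and> fst (hd s) = i then snd (hd s) else \<one>\<^bsub>P i\<^esub>)"

definition trailing :: "bool \<Rightarrow> (bool \<times> 'c) list \<Rightarrow> (bool \<times> 'c) list" where
  "trailing i s = (if s \<noteq> [] \<and> fst (hd s) = i then tl s else s)"

definition push :: "bool \<Rightarrow> 'c \<Rightarrow> (bool \<times> 'c) list \<Rightarrow> (bool \<times> 'c) list" where
  "push i m s = (if m = \<one>\<^bsub>P i\<^esub> then s else (i, m) # s)"

definition act :: "bool \<Rightarrow> 'c \<Rightarrow> (bool \<times> 'c) list \<Rightarrow> (bool \<times> 'c) list" where
  "act i m s = push i (m \<otimes>\<^bsub>P i\<^esub> leading i s) (trailing i s)"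

lemma leading_trailing:
  assumes "s \<in> seqs"
  shows "leading i s \<in> carrier (P i)" "trailing i s \<in> seqs"
    "trailing i s = [] \<or> fst (hd (trailing i s)) \<noteq> i" "push i (leading i s) (trailing i s) = s"
  using assms monoid.one_closed[OF monoid_P]
  by (cases s; auto simp: leading_def trailing_def push_def alternating_Cons)+

lemma leading_trailing_push:
  assumes "s = [] \<or> fst (hd s) \<noteq> i"
  shows "leading i (push i m s) = m" "trailing i (push i m s) = s"
  using assms by (auto simp: leading_def trailing_def push_def)

lemma act_in_seqs: "s \<in> seqs \<Longrightarrow> m \<in> carrier (P i) \<Longrightarrow> act i m s \<in> seqs"
  using leading_trailing[of s i] monoid.m_closed[OF monoid_P]
  by (auto simp: act_def push_def alternating_Cons)

lemma act_one: "s \<in> seqs \<Longrightarrow> act i \<one>\<^bsub>P i\<^esub> s = s"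
  using leading_trailing[of s i] by (simp add: act_def monoid.l_one[OF monoid_P])

text \<open>Splitting undoes \<open>push\<close>, so the second action meets the leading entry left
  by the first, and associativity merges the two multiplications.\<close>

lemma act_mult:
  "s \<in> seqs \<Longrightarrow> m \<in> carrier (P i) \<Longrightarrow> n \<in> carrier (P i) \<Longrightarrow>
    act i m (act i n s) = act i (m \<otimes>\<^bsub>P i\<^esub> n) s"
  using leading_trailing[of s i]
  by (simp add: act_def leading_trailing_push monoid.m_assoc[OF monoid_P])

lemma act_Cons:
  assumes "s = [] \<or> fst (hd s) \<noteq> i" "m \<in> carrier (P i)" "m \<noteq> \<one>\<^bsub>P i\<^esub>"
  shows "act i m s = (i, m) # s"
  using assms by (auto simp: act_def leading_def trailing_def push_def monoid.r_one[OF monoid_P])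

end

section \<open>Normal forms in a free product of presented monoids\<close>

locale presentation_pair =
  fixes A :: "bool \<Rightarrow> 'a set" and \<R> :: "bool \<Rightarrow> ('a list \<times> 'a list) set"
  assumes relations: "\<R> i \<subseteq> lists (A i) \<times> lists (A i)"
    and disjoint: "A False \<inter> A True = {}"
begin

abbreviation C :: "bool \<Rightarrow> ('a list \<times> 'a list) set" where
  "C i \<equiv> presentation_congruence (A i) (\<R> i)"

abbreviation C' :: "('a list \<times> 'a list) set" where
  "C' \<equiv> presentation_congruence (A False \<union> A True) (\<R> False \<union> \<R> True)"

sublocale monoid_pair "\<lambda>i. presented_monoid (A i) (\<R> i)"
  by (rule monoid_pair.intro, rule monoid_presented_monoid[OF relations])

lemma subset_generators: "A i \<subseteq> A False \<union> A True" "\<R> i \<subseteq> \<R> False \<union> \<R> True"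
  by (cases i; simp)+

lemma congruence_subset: "(u, v) \<in> C i \<Longrightarrow> (u, v) \<in> C'"
proof (induction rule: presentation_congruence.induct)
  case (relation u v x y)
  then show ?case
    using subset_generators[of i] lists_mono[OF subset_generators(1)[of i]]
    by (intro presentation_congruence.relation) auto
next
  case (refl u)
  then show ?case
    using lists_mono[OF subset_generators(1)[of i]] by (intro presentation_congruence.refl) auto
qed (auto intro: presentation_congruence.intros)

lemma class_in_carrier: "u \<in> lists (A i) \<Longrightarrow> C i `` {u} \<in> carrier (presented_monoid (A i) (\<R> i))"
  by (auto simp: presented_monoid_def intro: quotientI)

lemma class_Nil: "C i `` {[]} = \<one>\<^bsub>presented_monoid (A i) (\<R> i)\<^esub>"
  by (simp add: presented_monoid_def)

lemma class_eq_iff: "u \<in> lists (A i) \<Longrightarrow> v \<in> lists (A i) \<Longrightarrow> C i `` {u} = C i `` {v} \<longleftrightarrow> (u, v) \<in> C i"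
  by (rule eq_equiv_class_iff[OF equiv_presentation_congruence[OF relations]])

text \<open>The joint action of words over both alphabets. A letter acts through its own factor,
  which membership in \<open>A True\<close> decides because the alphabets are disjoint.\<close>

definition word_act :: "'a list \<Rightarrow> (bool \<times> 'a list set) list \<Rightarrow> (bool \<times> 'a list set) list" where
  "word_act w s = foldr (\<lambda>a. act (a \<in> A True) (C (a \<in> A True) `` {[a]})) w s"

lemma word_act_append: "word_act (u @ v) s = word_act u (word_act v s)"
  by (simp add: word_act_def)

lemma word_act_in_seqs: "w \<in> lists (A False \<union> A True) \<Longrightarrow> s \<in> seqs \<Longrightarrow> word_act w s \<in> seqs"
proof (induction w)
  case (Cons a w)
  have "[a] \<in> lists (A (a \<in> A True))" using Cons.prems by (cases "a \<in> A True") auto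
  with Cons show ?case by (simp add: word_act_def act_in_seqs class_in_carrier del: in_lists_conv_set)
qed (simp add: word_act_def)

lemma word_act_factor:
  assumes "u \<in> lists (A i)" "s \<in> seqs"
  shows "word_act u s = act i (C i `` {u}) s"
  using assms(1)
proof (induction u)
  case Nil
  then show ?case using act_one[OF assms(2)] by (simp add: word_act_def class_Nil)
next
  case (Cons a u)
  have "(a \<in> A True) = i" using Cons.hyps disjoint by (cases i) auto
  moreover have "[a] \<in> lists (A i)" using Cons.hyps by simp
  ultimately have "word_act (a # u) s = act i (C i `` {[a]}) (act i (C i `` {u}) s)"
    using Cons.IH by (simp add: word_act_def)
  also have "\<dots> = act i (C i `` {[a] @ u}) s"
    using Cons.hyps \<open>[a] \<in> lists (A i)\<close>
    by (simp add: act_mult[OF assms(2) class_in_carrier class_in_carrier]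
        presented_monoid_mult_class[OF relations] del: in_lists_conv_set lists.Cons)
  finally show ?case by simp
qed

text \<open>A defining relation belongs to one factor, where both sides have the same class and, by
  \<open>word_act_factor\<close>, the same action. Hence the action passes to the quotient by
  \<open>C'\<close>.\<close>

lemma word_act_congruence:
  assumes "(u, v) \<in> C'" "s \<in> seqs"
  shows "word_act u s = word_act v s"
  using assms
proof (induction arbitrary: s rule: presentation_congruence.induct)
  case (relation u v x y)
  then obtain i where uv: "(u, v) \<in> \<R> i" by blast
  with relations[of i] have "u \<in> lists (A i)" "v \<in> lists (A i)" by auto
  moreover have "(u, v) \<in> C i"
    using presentation_congruence.relation[OF uv, of "[]" "A i" "[]"] by simp
  ultimately have "word_act u t = word_act v t" if "t \<in> seqs" for t
    using that class_eq_iff[of u i v] by (simp add: word_act_factor del: in_lists_conv_set)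
  with relation show ?case
    by (simp add: word_act_append word_act_in_seqs del: in_lists_conv_set)
qed auto

text \<open>The factors embed in the free product: acting on the empty sequence recovers the class
  of a word in its factor.\<close>

lemma congruence_factor:
  assumes "u \<in> lists (A i)" "v \<in> lists (A i)"
  shows "(u, v) \<in> C' \<longleftrightarrow> (u, v) \<in> C i"
proof
  assume "(u, v) \<in> C'"
  from word_act_congruence[OF this, of "[]"]
  have "push i (C i `` {u}) [] = push i (C i `` {v}) []"
    using assms by (simp add: word_act_factor act_def leading_def trailing_def
      monoid.r_one[OF monoid_P] class_in_carrier del: in_lists_conv_set)
  then have "C i `` {u} = C i `` {v}" by (auto simp: push_def split: if_splits)
  with assms show "(u, v) \<in> C i" by (simp add: class_eq_iff del: in_lists_conv_set)
qed (rule congruence_subset)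

text \<open>The normal form theorem. Existence follows by multiplying the letters of a word one at a
  time into a normal form; uniqueness follows since the action on the empty sequence depends only on
  the product and returns the entries of the normal form as classes.\<close>

lemma free_factors:
  assumes "monoid M" and hom: "\<phi> \<in> hom (free_monoid (A False \<union> A True)) M"
    and Nil: "\<phi> [] = \<one>\<^bsub>M\<^esub>" and surj: "\<phi> ` lists (A False \<union> A True) = carrier M"
    and ker: "\<And>u v. u \<in> lists (A False \<union> A True) \<Longrightarrow> v \<in> lists (A False \<union> A True) \<Longrightarrow>
      \<phi> u = \<phi> v \<longleftrightarrow> (u, v) \<in> C'"
  shows "free_factors M (\<lambda>i. \<phi> ` lists (A i))"
proof -
  interpret M: monoid M by fact
  let ?N = "\<lambda>i. \<phi> ` lists (A i)" and ?L = "lists (A False \<union> A True)"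
  have sub: "u \<in> ?L" if "u \<in> lists (A i)" for u i
    using that lists_mono[OF subset_generators(1)[of i]] by blast
  have append: "\<phi> (u @ v) = \<phi> u \<otimes>\<^bsub>M\<^esub> \<phi> v" if "u \<in> ?L" "v \<in> ?L" for u v
    using hom that by (simp add: hom_def free_monoid_def)
  have closed: "\<phi> u \<in> carrier M" if "u \<in> ?L" for u
    using surj that by blast
  show ?thesis
  proof
    show N: "?N i \<subseteq> carrier M" for i using closed sub by blast
    show "\<one>\<^bsub>M\<^esub> \<in> ?N i" for i using Nil by (metis image_eqI lists.Nil)
    show N_mult: "x \<otimes>\<^bsub>M\<^esub> y \<in> ?N i" if "x \<in> ?N i" "y \<in> ?N i" for x y i
    proof -
      from that obtain u v where "u \<in> lists (A i)" "v \<in> lists (A i)" "x = \<phi> u" "y = \<phi> v" by blast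
      with append[OF sub sub, of u i v i] show ?thesis
        by (metis append_in_lists_conv image_eqI)
    qed
    let ?S = "alternating (\<lambda>i. ?N i - {\<one>\<^bsub>M\<^esub>})"
    have prod_closed: "seq_prod M s \<in> carrier M" if "s \<in> ?S" for s
      using that
    proof (induction s)
      case (Cons x s)
      then obtain i m where "x = (i, m)" "m \<in> ?N i" "s \<in> ?S"
        by (cases x) (auto simp: alternating_Cons)
      with Cons.IH N[of i] show ?case by auto
    qed simp
    \<comment> \<open>A new element of a factor is trivial, is prepended, cancels against the first
      entry, or merges with it.\<close>
    have multiply: "\<exists>t\<in>?S. seq_prod M t = m \<otimes>\<^bsub>M\<^esub> seq_prod M s" if "s \<in> ?S" "m \<in> ?N i" for s m i
    proof -
      have m: "m \<in> carrier M" using that N by blast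
      consider "m = \<one>\<^bsub>M\<^esub>" | "m \<noteq> \<one>\<^bsub>M\<^esub>" "s = [] \<or> fst (hd s) \<noteq> i"
        | n s' where "s = (i, n) # s'" "m \<otimes>\<^bsub>M\<^esub> n = \<one>\<^bsub>M\<^esub>"
        | n s' where "s = (i, n) # s'" "m \<otimes>\<^bsub>M\<^esub> n \<noteq> \<one>\<^bsub>M\<^esub>"
        by (cases s) force+
      then show ?thesis
      proof cases
        case 1
        with that prod_closed show ?thesis by (intro bexI[of _ s]) auto
      next
        case 2
        with that show ?thesis by (intro bexI[of _ "(i, m) # s"]) (auto simp: alternating_Cons)
      next
        case 3
        with that have "n \<in> carrier M" "s' \<in> ?S" using N by (auto simp: alternating_Cons)
        with 3 m prod_closed show ?thesis
          by (intro bexI[of _ s']) (simp_all flip: M.m_assoc)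
      next
        case 4
        with that have "n \<in> ?N i" "s' \<in> ?S" "s' = [] \<or> fst (hd s') \<noteq> i"
          by (auto simp: alternating_Cons)
        moreover from this N have "n \<in> carrier M" by blast
        ultimately show ?thesis using 4 m prod_closed N_mult[OF that(2)]
          by (intro bexI[of _ "(i, m \<otimes>\<^bsub>M\<^esub> n) # s'"]) (simp_all add: alternating_Cons M.m_assoc)
      qed
    qed
    have "\<exists>s\<in>?S. seq_prod M s = \<phi> w" if "w \<in> ?L" for w
      using that
    proof (induction w)
      case Nil
      then show ?case using \<open>\<phi> [] = \<one>\<^bsub>M\<^esub>\<close> by (intro bexI[of _ "[]"]) simp_all
    next
      case (Cons a w)
      then obtain s i where "s \<in> ?S" "seq_prod M s = \<phi> w" "[a] \<in> lists (A i)" by fastforce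
      with multiply[of s "\<phi> [a]" i] append[of "[a]" w] Cons.hyps show ?case by auto
    qed
    with surj show "\<exists>s\<in>?S. seq_prod M s = x" if "x \<in> carrier M" for x
      using that by (metis (no_types, lifting) imageE)
    \<comment> \<open>Entries are spelled by chosen words: \<open>W\<close> concatenates these to a
      word for the whole sequence, and \<open>f\<close> replaces each entry by the class of its
      word.\<close>
    define pick where "pick i m = (SOME u. u \<in> lists (A i) \<and> \<phi> u = m)" for i m
    have pick: "pick i m \<in> lists (A i)" "\<phi> (pick i m) = m" if "m \<in> ?N i" for i m
      using that someI_ex[of "\<lambda>u. u \<in> lists (A i) \<and> \<phi> u = m"] by (auto simp: pick_def)
    define W where "W s = concat (map (\<lambda>(i, m). pick i m) s)" for s
    define f where "f = (\<lambda>(i, m). (i, C i `` {pick i m}))"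
    have W: "W s \<in> ?L" "\<phi> (W s) = seq_prod M s" if "s \<in> ?S" for s
    proof -
      have "W s \<in> ?L \<and> \<phi> (W s) = seq_prod M s"
        using that
      proof (induction s)
        case (Cons x s)
        then obtain i m where x: "x = (i, m)" "m \<in> ?N i" "s \<in> ?S"
          by (cases x) (auto simp: alternating_Cons)
        then have "W (x # s) = pick i m @ W s" "pick i m \<in> ?L"
          using pick(1)[OF x(2)] sub by (auto simp: W_def)
        with x Cons.IH append pick(2)[OF x(2)] show ?case by simp
      qed (simp add: W_def Nil)
      then show "W s \<in> ?L" "\<phi> (W s) = seq_prod M s" by simp_all
    qed
    have f: "map f s \<in> seqs \<and> word_act (W s) [] = map f s" if "s \<in> ?S" for s
      using that
    proof (induction s)
      case (Cons x s)
      obtain i m where [simp]: "x = (i, m)" by fastforce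
      from Cons have *: "m \<in> ?N i" "m \<noteq> \<one>\<^bsub>M\<^esub>" "s \<in> ?S" "s = [] \<or> fst (hd s) \<noteq> i"
        by (auto simp: alternating_Cons)
      have lists: "pick i m \<in> lists (A i)" "[] \<in> lists (A i)" using pick * by auto
      \<comment> \<open>An entry different from the identity of \<open>M\<close> is nontrivial in
        its presented factor as well, so acting with it prepends it by
        \<open>act_Cons\<close>.\<close>
      have "C i `` {pick i m} \<noteq> C i `` {[]}"
        using * pick[OF *(1)] ker[OF sub sub, OF lists] class_eq_iff[OF lists] congruence_factor[OF lists] Nil
        by auto
      moreover have "map f s = [] \<or> fst (hd (map f s)) \<noteq> i"
        using *(4) by (auto simp: f_def hd_map split: prod.splits)
      moreover have "word_act (W (x # s)) [] = act i (C i `` {pick i m}) (map f s)"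
        using Cons.IH[OF *(3)] word_act_factor[OF lists(1)] by (simp add: W_def word_act_append)
      ultimately show ?case
        using Cons.IH[OF *(3)] class_in_carrier[OF lists(1)] act_Cons[of "map f s" i]
        by (simp add: alternating_Cons f_def class_Nil)
    qed (simp add: W_def word_act_def)
    show "s = t" if st: "s \<in> ?S" "t \<in> ?S" "seq_prod M s = seq_prod M t" for s t
    proof -
      have "(W s, W t) \<in> C'" using ker[of "W s" "W t"] W st by metis
      then have "word_act (W s) [] = word_act (W t) []"
        by (rule word_act_congruence) simp
      then have "map f s = map f t" using f st by metis
      \<comment> \<open>Injectivity is restricted to the entries that occur: these lie in the
        factors, where \<open>pick\<close> returns a genuine preimage.\<close>
      moreover have "inj_on f (set s \<union> set t)"
      proof (rule inj_onI, clarify)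
        fix i m j n
        assume "(i, m) \<in> set s \<union> set t" "(j, n) \<in> set s \<union> set t" and eq: "f (i, m) = f (j, n)"
        then have mn: "m \<in> ?N i" "n \<in> ?N j" using st by (auto simp: alternating_def)
        from eq have "i = j" "C i `` {pick i m} = C i `` {pick i n}" by (auto simp: f_def)
        with mn pick[OF mn(1)] pick[OF mn(2)] have "(pick i m, pick i n) \<in> C i"
          by (simp add: class_eq_iff del: in_lists_conv_set)
        then have "\<phi> (pick i m) = \<phi> (pick i n)"
          using ker congruence_subset sub pick mn \<open>i = j\<close> by metis
        with pick mn \<open>i = j\<close> show "i = j \<and> m = n" by simp
      qed
      ultimately show ?thesis by (simp add: inj_on_map_eq_map)
    qed
  qed
qed

end

text \<open>Both monoids are quotients of the same free monoid by the same congruence;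
  \<open>h\<close> evaluates any preimage in the second monoid.\<close>

lemma iso_of_same_kernel:
  assumes \<phi>: "\<phi> \<in> hom (free_monoid A) M" "\<phi> ` lists A = carrier M"
    and \<psi>: "\<psi> \<in> hom (free_monoid A) M'" "\<psi> ` lists A = carrier M'"
    and ker: "\<And>u v. u \<in> lists A \<Longrightarrow> v \<in> lists A \<Longrightarrow> \<phi> u = \<phi> v \<longleftrightarrow> \<psi> u = \<psi> v"
  shows "M \<cong> M'"
proof -
  define h where "h x = \<psi> (inv_into (lists A) \<phi> x)" for x
  have h: "h (\<phi> u) = \<psi> u" if "u \<in> lists A" for u
    using that ker[of "inv_into (lists A) \<phi> (\<phi> u)" u]
    by (simp add: h_def f_inv_into_f inv_into_into del: in_lists_conv_set)
  have "h \<in> hom M M'"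
  proof (rule homI)
    show "h x \<in> carrier M'" if "x \<in> carrier M" for x
      using that \<phi>(2) \<psi>(2) h by (metis (no_types, lifting) imageE imageI)
    show "h (x \<otimes>\<^bsub>M\<^esub> y) = h x \<otimes>\<^bsub>M'\<^esub> h y" if "x \<in> carrier M" "y \<in> carrier M" for x y
    proof -
      from that \<phi>(2) obtain u v where uv: "u \<in> lists A" "v \<in> lists A" "x = \<phi> u" "y = \<phi> v" by blast
      then have "\<phi> (u @ v) = x \<otimes>\<^bsub>M\<^esub> y" "\<psi> (u @ v) = \<psi> u \<otimes>\<^bsub>M'\<^esub> \<psi> v"
        using \<phi>(1) \<psi>(1) by (auto simp: hom_def free_monoid_def)
      with uv h h[of "u @ v"] show ?thesis by simp
    qed
  qed
  moreover have "inj_on h (carrier M)"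
    unfolding \<phi>(2)[symmetric]
  proof (rule inj_onI, elim imageE)
    fix x y u v assume "h x = h y" "x = \<phi> u" "u \<in> lists A" "y = \<phi> v" "v \<in> lists A"
    with h ker[of u v] show "x = y" by simp
  qed
  moreover have "h ` carrier M = carrier M'"
    unfolding \<phi>(2)[symmetric] \<psi>(2)[symmetric] image_image using h by (intro image_cong) auto
  ultimately show ?thesis by (auto simp: is_iso_def iso_def bij_betw_def)
qed

section \<open>The combing of a free product\<close>

lemma inj_Letter: "inj Letter"
  by (rule injI) simp

lemma append_Cons_eq_iff_first:
  assumes "h \<notin> set u" "h \<notin> set v"
  shows "u @ h # x = v @ h # y \<longleftrightarrow> u = v \<and> x = y"
  using assms
proof (induction u arbitrary: v)
  case Nil
  then show ?case by (cases v) auto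
next
  case (Cons a u)
  then show ?case by (cases v) auto
qed

lemma Letter_append_eq_iff:
  assumes "h = Hash1 \<or> h = Hash2"
  shows "map Letter u @ h # x = map Letter v @ h # y \<longleftrightarrow> u = v \<and> x = y"
  using assms by (subst append_Cons_eq_iff_first) (auto simp: inj_map_eq_map[OF inj_Letter])

text \<open>Markers never occur among letters, so a marked word can be cut into its parts in only
  one way.\<close>

lemma marked_product_eq_iff:
  "marked_product u v w = marked_product u' v' w' \<longleftrightarrow> u = u' \<and> v = v' \<and> w = w'"
  by (simp add: Letter_append_eq_iff inj_map_eq_map[OF inj_Letter] del: rev_map)

lemma marked_product_in_table:
  "marked_product u v w \<in> multiplication_table \<pi> R \<longleftrightarrow>
     u \<in> R \<and> v \<in> R \<and> w \<in> R \<and> \<pi> (u @ v) = \<pi> w"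
  unfolding multiplication_table_def mem_Collect_eq marked_product_eq_iff by blast

lemma context_free_singleton: "context_free {w}"
proof -
  have "context_free (generated_language {(0 :: nat, map Terminal w)} 0)"
    by (rule context_free_generated_language) simp
  also have "generated_language {(0 :: nat, map Terminal w)} 0 = {w}"
    by (auto simp: generated_language_eq yields_single)
  finally show ?thesis .
qed

datatype table_symbol = Product | Cancel | Copy

definition letters :: "bool \<Rightarrow> nat list \<Rightarrow> ('n, nat marked) symbol list" where
  "letters i u = map Terminal (map Letter (map (tagged i) u))"

lemma interp_letters [simp]: "interp I (letters i u) = {map Letter (map (tagged i) u)}"
  unfolding letters_def by (rule interp_map_Terminal)

lemma yields_letters: "yields P (letters i u) (map Letter (map (tagged i) u))"
  unfolding letters_def by (simp only: yields_map_Terminal)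

section \<open>Combings of the factors and evaluation of alternating words\<close>

text \<open>Common setting of both variants: each combing has exactly one word \<open>e i\<close>
  for the identity. Under 1-uniqueness this word is empty; under uniqueness it may be any
  word.\<close>

locale combing_pair = free_factors M N for M :: "('p, 'z) monoid_scheme" (structure) and N +
  fixes A :: "bool \<Rightarrow> nat set" and \<rho> :: "bool \<Rightarrow> nat list \<Rightarrow> 'p"
    and R :: "bool \<Rightarrow> nat list set" and e :: "bool \<Rightarrow> nat list"
  assumes factor_hyperbolic: "word_hyperbolic_wrt (M\<lparr>carrier := N i\<rparr>) (A i) (\<rho> i) (R i)"
    and identity_word: "{w \<in> R i. \<rho> i w = \<one>} = {e i}"
begin

lemma finite_alphabet: "finite (A i)"
  and \<rho>_append: "u \<in> lists (A i) \<Longrightarrow> v \<in> lists (A i) \<Longrightarrow> \<rho> i (u @ v) = \<rho> i u \<otimes> \<rho> i v"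
  and \<rho>_Nil: "\<rho> i [] = \<one>"
  and \<rho>_lists: "\<rho> i ` lists (A i) = N i"
  and regular_R: "regular_language (A i) (R i)"
  and \<rho>_R: "\<rho> i ` R i = N i"
  and table: "context_free (multiplication_table (\<rho> i) (R i))"
  using factor_hyperbolic[of i]
  by (auto simp: word_hyperbolic_wrt_def generated_via_def regular_combing_def free_monoid_def hom_def)

lemma R_lists: "R i \<subseteq> lists (A i)"
  using regular_R[of i] by (auto simp: regular_language_def)

lemma \<rho>_in_N: "u \<in> lists (A i) \<Longrightarrow> \<rho> i u \<in> N i"
  using \<rho>_lists by blast

lemma \<rho>_closed: "u \<in> lists (A i) \<Longrightarrow> \<rho> i u \<in> carrier M"
  using \<rho>_in_N factor_subset by blast

lemma e: "e i \<in> R i" "\<rho> i (e i) = \<one>" "w \<in> R i \<Longrightarrow> \<rho> i w = \<one> \<Longrightarrow> w = e i"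
  using identity_word[of i] by auto

definition A' :: "nat set" where
  "A' = (\<Union>i. tagged i ` A i)"

definition \<pi> :: "nat list \<Rightarrow> 'p" where
  "\<pi> w = foldr (\<lambda>a x. \<rho> (odd a) [a div 2] \<otimes> x) w \<one>"

text \<open>Blocks are to represent elements other than the identity. The empty word never lies in
  \<open>B i\<close>: if it belongs to \<open>R i\<close>, it must be \<open>e i\<close>.\<close>

definition B :: "bool \<Rightarrow> nat list set" where
  "B i = R i - {e i}"

definition R' :: "nat list set" where
  "R' = block_word ` alternating B"

abbreviation val :: "bool \<times> nat list \<Rightarrow> bool \<times> 'p" where
  "val \<equiv> \<lambda>(i, u). (i, \<rho> i u)"

lemma B_lists: "B i \<subseteq> lists (A i)"
  using R_lists by (auto simp: B_def)

lemma B_R: "u \<in> B i \<Longrightarrow> u \<in> R i"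
  by (simp add: B_def)

lemma block_word_lists: "bs \<in> alternating B \<Longrightarrow> block_word bs \<in> lists A'"
  unfolding A'_def by (rule block_word_in_lists[OF _ B_lists])

lemma tagged_lists: "u \<in> lists (A i) \<Longrightarrow> map (tagged i) u \<in> lists A'"
  by (fastforce simp: A'_def)

lemma \<pi>_closed: "w \<in> lists A' \<Longrightarrow> \<pi> w \<in> carrier M"
  by (induction w) (auto simp: \<pi>_def A'_def intro!: m_closed \<rho>_closed)

lemma \<pi>_append:
  assumes "u \<in> lists A'" "v \<in> lists A'"
  shows "\<pi> (u @ v) = \<pi> u \<otimes> \<pi> v"
  using assms(1)
proof (induction u)
  case Nil
  show ?case using \<pi>_closed[OF assms(2)] by (simp add: \<pi>_def)
next
  case (Cons a u)
  then have "\<rho> (odd a) [a div 2] \<in> carrier M" by (auto simp: A'_def intro!: \<rho>_closed)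
  with Cons show ?case
    using \<pi>_closed[OF assms(2)] \<pi>_closed[of u] by (simp add: \<pi>_def m_assoc)
qed

lemma \<pi>_tagged: "u \<in> lists (A i) \<Longrightarrow> \<pi> (map (tagged i) u) = \<rho> i u"
proof (induction u)
  case Nil
  show ?case by (simp add: \<pi>_def \<rho>_Nil)
next
  case (Cons a u)
  then have "\<rho> i ([a] @ u) = \<rho> i [a] \<otimes> \<rho> i u" by (intro \<rho>_append) auto
  with Cons show ?case by (simp add: \<pi>_def)
qed

lemma \<pi>_block_word: "bs \<in> alternating B \<Longrightarrow> \<pi> (block_word bs) = seq_prod M (map val bs)"
proof (induction bs)
  case Nil
  show ?case by (simp add: \<pi>_def)
next
  case (Cons b bs)
  obtain i u where b: "b = (i, u)" by fastforce
  with Cons have "u \<in> lists (A i)" "bs \<in> alternating B"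
    using B_lists by (auto simp: alternating_Cons)
  with Cons.IH b show ?case
    by (simp add: \<pi>_append tagged_lists block_word_lists \<pi>_tagged del: in_lists_conv_set)
qed

lemma val_alternating:
  assumes "bs \<in> alternating B"
  shows "map val bs \<in> alternating (\<lambda>i. N i - {\<one>})"
proof -
  have "fst \<circ> val = fst" by auto
  moreover have "\<rho> i u \<in> N i - {\<one>}" if "u \<in> B i" for i u
    using that e(3)[of u i] \<rho>_R by (auto simp: B_def)
  ultimately show ?thesis
    using assms unfolding alternating_def mem_Collect_eq by auto
qed

lemma val_surj:
  "s \<in> alternating (\<lambda>i. N i - {\<one>}) \<Longrightarrow> \<exists>bs\<in>alternating B. map val bs = s"
proof (induction s)
  case (Cons x s)
  then obtain i m where x: "x = (i, m)" "m \<in> N i" "m \<noteq> \<one>"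
    "s \<in> alternating (\<lambda>i. N i - {\<one>})" "s = [] \<or> fst (hd s) \<noteq> i"
    by (cases x) (auto simp: alternating_Cons)
  with Cons.IH obtain bs where bs: "bs \<in> alternating B" "map val bs = s" by blast
  from x(2) have "m \<in> \<rho> i ` R i" by (simp only: \<rho>_R)
  then obtain u where "u \<in> R i" "\<rho> i u = m" by blast
  with x bs e(2)[of i] have "(i, u) # bs \<in> alternating B" "map val ((i, u) # bs) = x # s"
    by (auto simp: alternating_Cons B_def hd_map split: prod.splits)
  then show ?case by (rule bexI[rotated])
qed auto

lemma seq_prod_val_closed: "bs \<in> alternating B \<Longrightarrow> seq_prod M (map val bs) \<in> carrier M"
  using \<pi>_block_word \<pi>_closed block_word_lists by metis

text \<open>Normal forms fix the elements represented by the blocks, but not the blocks themselves,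
  since \<open>R i\<close> may contain several words for one element.\<close>

lemma val_unique:
  "bs \<in> alternating B \<Longrightarrow> cs \<in> alternating B \<Longrightarrow> \<pi> (block_word bs) = \<pi> (block_word cs) \<Longrightarrow>
    map val bs = map val cs"
  by (rule normal_form_unique[OF val_alternating val_alternating]) (simp_all add: \<pi>_block_word)

section \<open>Right-hand sides from the tables of the factors\<close>

text \<open>Equal values are asked for instead of equal words, because without uniqueness the result
  may spell a copied element differently.\<close>

definition copy_rhs :: "bool \<Rightarrow> table_symbol \<Rightarrow> (table_symbol, nat marked) symbol list set" where
  "copy_rhs i X = {letters i u @ [Nonterminal X] @ letters i (rev w) |u w.
     u \<in> R i \<and> w \<in> R i \<and> \<rho> i u = \<rho> i w}"

definition cancel_rhs :: "bool \<Rightarrow> (table_symbol, nat marked) symbol list set" where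
  "cancel_rhs i = {letters i u @ [Nonterminal Cancel] @ letters i v |u v.
     u \<in> R i \<and> v \<in> R i \<and> \<rho> i (u @ v) = \<one>}"

definition product_rhs :: "bool \<Rightarrow> (table_symbol, nat marked) symbol list set" where
  "product_rhs i = {letters i u @ [Nonterminal Cancel] @ letters i v @ [Nonterminal Copy] @
     letters i (rev w) |u v w. u \<in> R i \<and> v \<in> R i \<and> w \<in> R i \<and> \<rho> i (u @ v) = \<rho> i w}"

definition letter_subst :: "bool \<Rightarrow> nat marked \<Rightarrow> (table_symbol, nat marked) symbol list" where
  "letter_subst i c = (case c of Letter a \<Rightarrow> [Terminal (Letter (tagged i a))]
     | Hash1 \<Rightarrow> [Nonterminal Cancel] | Hash2 \<Rightarrow> [Nonterminal Copy])"

lemma letter_subst [simp]: "concat (map (letter_subst i) (map Letter u)) = letters i u"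
  "letter_subst i Hash1 = [Nonterminal Cancel]" "letter_subst i Hash2 = [Nonterminal Copy]"
  by (induction u) (auto simp: letter_subst_def letters_def)

text \<open>Pairs of words with equal value are the table entries with middle word
  \<open>e i\<close>; this word and the two markers around it are rewritten to the
  nonterminal.\<close>

lemma context_free_copy_rhs: "context_free (copy_rhs i X)"
proof -
  let ?h = "\<lambda>x. concat (map (letter_subst i) x)" and ?t = "Hash1 # map Letter (e i) @ [Hash2]"
  let ?K = "{?h x @ [Nonterminal X] @ ?h y |x y. x \<in> lists (range Letter) \<and> y \<in> lists (range Letter) \<and>
    x @ ?t @ y \<in> multiplication_table (\<rho> i) (R i)}"
  have *: "map Letter u @ ?t @ map Letter w \<in> multiplication_table (\<rho> i) (R i) \<longleftrightarrow>
      u \<in> R i \<and> rev w \<in> R i \<and> \<rho> i u = \<rho> i (rev w)" for u w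
  proof -
    have "map Letter u @ ?t @ map Letter w = marked_product u (e i) (rev w)" by simp
    moreover have "\<rho> i (u @ e i) = \<rho> i u" if "u \<in> R i"
    proof -
      have "u \<in> lists (A i)" "e i \<in> lists (A i)" using that e(1) R_lists by blast+
      then show ?thesis by (simp add: \<rho>_append e(2) \<rho>_closed del: in_lists_conv_set)
    qed
    ultimately show ?thesis
      using e(1)[of i] marked_product_in_table[of u "e i" "rev w" "\<rho> i" "R i"] by auto
  qed
  have "?K = copy_rhs i X"
  proof (intro equalityI subsetI)
    fix z assume "z \<in> ?K"
    then obtain u w where "z = letters i u @ [Nonterminal X] @ letters i w"
      "map Letter u @ ?t @ map Letter w \<in> multiplication_table (\<rho> i) (R i)"
      unfolding lists_image by (auto simp del: map_map)
    with * show "z \<in> copy_rhs i X"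
      unfolding copy_rhs_def mem_Collect_eq by (intro exI[of _ u] exI[of _ "rev w"]) auto
  next
    fix z assume "z \<in> copy_rhs i X"
    then obtain u w where "z = letters i u @ [Nonterminal X] @ letters i (rev w)"
      "u \<in> R i" "w \<in> R i" "\<rho> i u = \<rho> i w" by (auto simp: copy_rhs_def)
    with *[of u "rev w"] show "z \<in> ?K"
      unfolding mem_Collect_eq
      by (intro exI[of _ "map Letter u"] exI[of _ "map Letter (rev w)"]) (auto simp del: map_map)
  qed
  moreover have "context_free ?K" by (rule context_free_rewrite[OF table]) simp
  ultimately show ?thesis by simp
qed

text \<open>Pairs with product one are the table entries with third word \<open>e i\<close>. The
  marker \<open>Hash2\<close> and everything behind it are erased; excluding \<open>Hash2\<close> in
  front and allowing nothing behind forces the erased part to be the whole tail.\<close>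

lemma context_free_cancel_rhs: "context_free (cancel_rhs i)"
proof -
  let ?h = "\<lambda>x. concat (map (letter_subst i) x)" and ?t = "Hash2 # map Letter (rev (e i))"
  let ?K = "{?h x @ [] @ ?h y |x y. x \<in> lists (- {Hash2}) \<and> y \<in> lists {} \<and>
    x @ ?t @ y \<in> multiplication_table (\<rho> i) (R i)}"
  have "?K = cancel_rhs i"
  proof (intro equalityI subsetI)
    fix z assume "z \<in> ?K"
    then obtain x where x: "z = ?h x" "Hash2 \<notin> set x" "x @ ?t \<in> multiplication_table (\<rho> i) (R i)"
      by auto
    then obtain u v w where uvw: "u \<in> R i" "v \<in> R i" "w \<in> R i" "\<rho> i (u @ v) = \<rho> i w"
      "x @ ?t = marked_product u v w" by (auto simp: multiplication_table_def)
    then have "x @ Hash2 # map Letter (rev (e i)) =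
        (map Letter u @ Hash1 # map Letter v) @ Hash2 # map Letter (rev w)" by simp
    then have x': "x = map Letter u @ Hash1 # map Letter v" "map Letter (rev (e i)) = map Letter (rev w)"
      using x(2) append_Cons_eq_iff_first[of Hash2 x "map Letter u @ Hash1 # map Letter v"] by auto
    from x'(2) have "w = e i"
      using inj_map_eq_map[OF inj_Letter, of "rev (e i)" "rev w"] by simp
    with uvw(4) e(2) have "\<rho> i (u @ v) = \<one>" by simp
    moreover have "z = letters i u @ [Nonterminal Cancel] @ letters i v"
      unfolding x(1) x'(1) by (simp del: map_map)
    ultimately show "z \<in> cancel_rhs i"
      unfolding cancel_rhs_def using uvw(1,2) by blast
  next
    fix z assume "z \<in> cancel_rhs i"
    then obtain u v where uv: "z = letters i u @ [Nonterminal Cancel] @ letters i v"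
      "u \<in> R i" "v \<in> R i" "\<rho> i (u @ v) = \<one>" by (auto simp: cancel_rhs_def)
    with e(1,2) have "marked_product u v (e i) \<in> multiplication_table (\<rho> i) (R i)"
      by (simp only: marked_product_in_table)
    then have "(map Letter u @ Hash1 # map Letter v) @ ?t @ [] \<in> multiplication_table (\<rho> i) (R i)"
      by simp
    moreover have "z = ?h (map Letter u @ Hash1 # map Letter v) @ [] @ ?h []"
      using uv(1) by (simp del: map_map)
    moreover have "map Letter u @ Hash1 # map Letter v \<in> lists (- {Hash2})" by auto
    ultimately show "z \<in> ?K" by (intro CollectI exI conjI) (assumption | simp)+
  qed
  moreover have "context_free ?K" by (rule context_free_rewrite[OF table]) simp
  ultimately show ?thesis by simp
qed

text \<open>Here the full table is kept: \<open>Hash1\<close> serves as the nonempty pattern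
  required by \<open>context_free_rewrite\<close>, while \<open>Hash2\<close> is replaced by the
  letter substitution.\<close>

lemma context_free_product_rhs: "context_free (product_rhs i)"
proof -
  let ?h = "\<lambda>x. concat (map (letter_subst i) x)"
  let ?K = "{?h x @ [Nonterminal Cancel] @ ?h y |x y. x \<in> lists (range Letter) \<and> y \<in> lists UNIV \<and>
    x @ [Hash1] @ y \<in> multiplication_table (\<rho> i) (R i)}"
  have "?K = product_rhs i"
  proof (intro equalityI subsetI)
    fix z assume "z \<in> ?K"
    then obtain u y where z: "z = letters i u @ [Nonterminal Cancel] @ ?h y"
      "map Letter u @ [Hash1] @ y \<in> multiplication_table (\<rho> i) (R i)"
      unfolding lists_image by (auto simp del: map_map)
    then obtain u' v w where uvw: "u' \<in> R i" "v \<in> R i" "w \<in> R i" "\<rho> i (u' @ v) = \<rho> i w"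
      "map Letter u @ [Hash1] @ y = marked_product u' v w" by (auto simp: multiplication_table_def)
    then have "u = u'" "y = map Letter v @ [Hash2] @ map Letter (rev w)"
      by (simp_all add: Letter_append_eq_iff)
    with z uvw show "z \<in> product_rhs i"
      unfolding product_rhs_def mem_Collect_eq
      by (intro exI[of _ u] exI[of _ v] exI[of _ w]) (simp del: map_map)
  next
    fix z assume "z \<in> product_rhs i"
    then obtain u v w where uvw: "z = letters i u @ [Nonterminal Cancel] @ letters i v @
        [Nonterminal Copy] @ letters i (rev w)"
      "u \<in> R i" "v \<in> R i" "w \<in> R i" "\<rho> i (u @ v) = \<rho> i w" by (auto simp: product_rhs_def)
    then have "marked_product u v w \<in> multiplication_table (\<rho> i) (R i)"
      by (simp only: marked_product_in_table)
    with uvw show "z \<in> ?K"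
      unfolding mem_Collect_eq
      by (intro exI[of _ "map Letter u"] exI[of _ "map Letter v @ [Hash2] @ map Letter (rev w)"])
        (auto simp del: map_map)
  qed
  moreover have "context_free ?K" by (rule context_free_rewrite[OF table]) simp
  ultimately show ?thesis by simp
qed

section \<open>The product grammar\<close>

definition rules :: "(table_symbol \<times> (table_symbol, nat marked) symbol list set) set" where
  "rules = {(Product, {[Nonterminal Cancel, Nonterminal Copy]}), (Cancel, {[Terminal Hash1]}),
       (Copy, {[Terminal Hash2]})} \<union>
     (\<Union>i. {(Product, copy_rhs i Product), (Copy, copy_rhs i Copy), (Cancel, cancel_rhs i),
       (Product, product_rhs i)})"

definition P :: "(table_symbol, nat marked) productions" where
  "P = {(k, \<alpha>). \<exists>L. (k, L) \<in> rules \<and> \<alpha> \<in> L}"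

lemma context_free_P: "context_free (generated_language P X)"
  unfolding P_def
  by (rule context_free_extended_grammar)
    (auto simp: rules_def context_free_singleton context_free_copy_rhs context_free_cancel_rhs
      context_free_product_rhs)

lemma P_cases:
  assumes "(X, \<alpha>) \<in> P"
  obtains (split) "X = Product" "\<alpha> = [Nonterminal Cancel, Nonterminal Copy]"
  | (hash1) "X = Cancel" "\<alpha> = [Terminal Hash1]"
  | (hash2) "X = Copy" "\<alpha> = [Terminal Hash2]"
  | (copy) i u w where "X = Product \<or> X = Copy" "u \<in> R i" "w \<in> R i" "\<rho> i u = \<rho> i w"
      "\<alpha> = letters i u @ [Nonterminal X] @ letters i (rev w)"
  | (cancel) i u v where "X = Cancel" "u \<in> R i" "v \<in> R i" "\<rho> i (u @ v) = \<one>"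
      "\<alpha> = letters i u @ [Nonterminal Cancel] @ letters i v"
  | (merge) i u v w where "X = Product" "u \<in> R i" "v \<in> R i" "w \<in> R i" "\<rho> i (u @ v) = \<rho> i w"
      "\<alpha> = letters i u @ [Nonterminal Cancel] @ letters i v @ [Nonterminal Copy] @ letters i (rev w)"
proof -
  from assms obtain L where L: "(X, L) \<in> rules" "\<alpha> \<in> L" by (auto simp: P_def)
  then consider "X = Product" "\<alpha> = [Nonterminal Cancel, Nonterminal Copy]"
    | "X = Cancel" "\<alpha> = [Terminal Hash1]" | "X = Copy" "\<alpha> = [Terminal Hash2]"
    | i where "X = Product \<or> X = Copy" "\<alpha> \<in> copy_rhs i X"
    | i where "X = Cancel" "\<alpha> \<in> cancel_rhs i" | i where "X = Product" "\<alpha> \<in> product_rhs i"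
    by (auto simp: rules_def)
  then show thesis
  proof cases
    case (4 i)
    then show ?thesis unfolding copy_rhs_def mem_Collect_eq using copy by metis
  next
    case (5 i)
    then show ?thesis unfolding cancel_rhs_def mem_Collect_eq using cancel by metis
  next
    case (6 i)
    then show ?thesis unfolding product_rhs_def mem_Collect_eq using merge by metis
  qed (use split hash1 hash2 in auto)
qed

lemma P_I: "(X, L) \<in> rules \<Longrightarrow> \<alpha> \<in> L \<Longrightarrow> (X, \<alpha>) \<in> P"
  by (auto simp: P_def)

lemma P_split: "(Product, [Nonterminal Cancel, Nonterminal Copy]) \<in> P"
  and P_hash1: "(Cancel, [Terminal Hash1]) \<in> P"
  and P_hash2: "(Copy, [Terminal Hash2]) \<in> P"
  by (auto simp: P_def rules_def)

lemma P_copy: "X = Product \<or> X = Copy \<Longrightarrow> u \<in> R i \<Longrightarrow> w \<in> R i \<Longrightarrow> \<rho> i u = \<rho> i w \<Longrightarrow>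
    (X, letters i u @ [Nonterminal X] @ letters i (rev w)) \<in> P"
  by (rule P_I[of _ "copy_rhs i X"]) (auto simp: rules_def copy_rhs_def)

lemma P_cancel: "u \<in> R i \<Longrightarrow> v \<in> R i \<Longrightarrow> \<rho> i (u @ v) = \<one> \<Longrightarrow>
    (Cancel, letters i u @ [Nonterminal Cancel] @ letters i v) \<in> P"
  by (rule P_I[of _ "cancel_rhs i"]) (auto simp: rules_def cancel_rhs_def)

lemma P_merge: "u \<in> R i \<Longrightarrow> v \<in> R i \<Longrightarrow> w \<in> R i \<Longrightarrow> \<rho> i (u @ v) = \<rho> i w \<Longrightarrow>
    (Product, letters i u @ [Nonterminal Cancel] @ letters i v @ [Nonterminal Copy] @
      letters i (rev w)) \<in> P"
  by (rule P_I[of _ "product_rhs i"]) (auto simp: rules_def product_rhs_def)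

section \<open>Soundness of the product grammar\<close>

lemma tagged_R_lists: "w \<in> R i \<Longrightarrow> map (tagged i) w \<in> lists A'"
  using R_lists tagged_lists by blast

text \<open>The assignment for \<open>yields_in_interp\<close>. Its words range over all of
  \<open>lists A'\<close>, since the grammar also derives words that are not alternating, for
  instance with neighbouring blocks of one factor or with \<open>e i\<close> as a block.\<close>

definition sound :: "table_symbol \<Rightarrow> nat marked list set" where
  "sound X = (case X of
     Product \<Rightarrow> {marked_product u v w |u v w.
       u \<in> lists A' \<and> v \<in> lists A' \<and> w \<in> lists A' \<and> \<pi> u \<otimes> \<pi> v = \<pi> w}
   | Cancel \<Rightarrow> {map Letter u @ [Hash1] @ map Letter v |u v.
       u \<in> lists A' \<and> v \<in> lists A' \<and> \<pi> u \<otimes> \<pi> v = \<one>}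
   | Copy \<Rightarrow> {map Letter v @ [Hash2] @ map Letter (rev w) |v w.
       v \<in> lists A' \<and> w \<in> lists A' \<and> \<pi> v = \<pi> w})"

lemma soundI:
  "u \<in> lists A' \<Longrightarrow> v \<in> lists A' \<Longrightarrow> w \<in> lists A' \<Longrightarrow> \<pi> u \<otimes> \<pi> v = \<pi> w \<Longrightarrow>
    z = marked_product u v w \<Longrightarrow> z \<in> sound Product"
  "u \<in> lists A' \<Longrightarrow> v \<in> lists A' \<Longrightarrow> \<pi> u \<otimes> \<pi> v = \<one> \<Longrightarrow>
    z = map Letter u @ [Hash1] @ map Letter v \<Longrightarrow> z \<in> sound Cancel"
  "v \<in> lists A' \<Longrightarrow> w \<in> lists A' \<Longrightarrow> \<pi> v = \<pi> w \<Longrightarrow>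
    z = map Letter v @ [Hash2] @ map Letter (rev w) \<Longrightarrow> z \<in> sound Copy"
  by (auto simp: sound_def)

lemma sound_ProductE:
  assumes "z \<in> sound Product"
  obtains u v w where "u \<in> lists A'" "v \<in> lists A'" "w \<in> lists A'" "\<pi> u \<otimes> \<pi> v = \<pi> w"
    "z = marked_product u v w"
  using assms by (auto simp: sound_def)

lemma sound_CancelE:
  assumes "z \<in> sound Cancel"
  obtains u v where "u \<in> lists A'" "v \<in> lists A'" "\<pi> u \<otimes> \<pi> v = \<one>"
    "z = map Letter u @ [Hash1] @ map Letter v"
  using assms by (auto simp: sound_def)

lemma sound_CopyE:
  assumes "z \<in> sound Copy"
  obtains v w where "v \<in> lists A'" "w \<in> lists A'" "\<pi> v = \<pi> w"
    "z = map Letter v @ [Hash2] @ map Letter (rev w)"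
  using assms by (auto simp: sound_def)

lemma \<pi>_R: "u \<in> R i \<Longrightarrow> \<pi> (map (tagged i) u) = \<rho> i u"
  using R_lists \<pi>_tagged by blast

lemma \<rho>_R_append: "u \<in> R i \<Longrightarrow> v \<in> R i \<Longrightarrow> \<rho> i (u @ v) = \<rho> i u \<otimes> \<rho> i v"
  using R_lists \<rho>_append by blast

lemma \<rho>_R_closed: "u \<in> R i \<Longrightarrow> \<rho> i u \<in> carrier M"
  using R_lists \<rho>_closed by blast

text \<open>Each production surrounds correct equations by blocks whose values satisfy a factor
  equation. The values multiply from outside, and the part derived from \<open>Cancel\<close>
  contributes the identity.\<close>

lemma interp_sound:
  assumes "(X, \<alpha>) \<in> P"
  shows "interp sound \<alpha> \<subseteq> sound X"
proof
  fix z assume z: "z \<in> interp sound \<alpha>"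
  have Nil: "\<pi> [] = \<one>" by (simp add: \<pi>_def)
  let ?t = "\<lambda>i u. map Letter (map (tagged i) u)"
  note simps = \<pi>_append \<pi>_R \<pi>_closed \<rho>_R_closed m_assoc
  from assms show "z \<in> sound X"
  proof (cases rule: P_cases)
    case split
    with z obtain x y where z: "z = x @ y" "x \<in> sound Cancel" "y \<in> sound Copy" by auto
    then obtain u v where uv: "u \<in> lists A'" "v \<in> lists A'" "\<pi> u \<otimes> \<pi> v = \<one>"
      "x = map Letter u @ [Hash1] @ map Letter v" by (elim sound_CancelE)
    from z obtain v' w where vw: "v' \<in> lists A'" "w \<in> lists A'" "\<pi> v' = \<pi> w"
      "y = map Letter v' @ [Hash2] @ map Letter (rev w)" by (elim sound_CopyE)
    have "\<pi> u \<otimes> \<pi> (v @ v') = (\<pi> u \<otimes> \<pi> v) \<otimes> \<pi> v'"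
      using uv(1,2) vw(1) by (simp add: simps del: in_lists_conv_set)
    with uv(3) vw have "\<pi> u \<otimes> \<pi> (v @ v') = \<pi> w" by (simp add: \<pi>_closed)
    with split uv vw z show ?thesis by (auto intro!: soundI(1)[of u "v @ v'" w])
  next
    case hash1
    with z show ?thesis by (auto intro!: soundI(2)[of "[]" "[]"] simp: Nil)
  next
    case hash2
    with z show ?thesis by (auto intro!: soundI(3)[of "[]" "[]"])
  next
    case (copy i u w)
    with z obtain y where y: "z = ?t i u @ y @ ?t i (rev w)" "y \<in> sound X"
      by (auto simp: interp_append)
    note tl = copy(2)[THEN tagged_R_lists] copy(3)[THEN tagged_R_lists]
    from copy(1) show ?thesis
    proof
      assume X: "X = Product"
      with y(2) have "y \<in> sound Product" by simp
      then obtain u' v w' where 1: "u' \<in> lists A'" "v \<in> lists A'" "w' \<in> lists A'"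
        "\<pi> u' \<otimes> \<pi> v = \<pi> w'" "y = marked_product u' v w'" by (elim sound_ProductE)
      with copy tl have "\<pi> (map (tagged i) u @ u') \<otimes> \<pi> v = \<pi> (map (tagged i) w @ w')"
        by (simp add: simps del: in_lists_conv_set)
      with X 1 y(1) tl show ?thesis
        by (auto intro!: soundI(1)[of "map (tagged i) u @ u'" v "map (tagged i) w @ w'"] simp: rev_map)
    next
      assume X: "X = Copy"
      with y(2) have "y \<in> sound Copy" by simp
      then obtain v w' where 3: "v \<in> lists A'" "w' \<in> lists A'" "\<pi> v = \<pi> w'"
        "y = map Letter v @ [Hash2] @ map Letter (rev w')" by (elim sound_CopyE)
      with copy tl have "\<pi> (map (tagged i) u @ v) = \<pi> (map (tagged i) w @ w')"
        by (simp add: simps del: in_lists_conv_set)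
      with X 3 y(1) tl show ?thesis
        by (auto intro!: soundI(3)[of "map (tagged i) u @ v" "map (tagged i) w @ w'"] simp: rev_map)
    qed
  next
    case (cancel i u v)
    with z obtain y where y: "z = ?t i u @ y @ ?t i v" "y \<in> sound Cancel"
      by (auto simp: interp_append)
    note tl = cancel(2)[THEN tagged_R_lists] cancel(3)[THEN tagged_R_lists]
    from y(2) obtain u' v' where uv: "u' \<in> lists A'" "v' \<in> lists A'" "\<pi> u' \<otimes> \<pi> v' = \<one>"
      "y = map Letter u' @ [Hash1] @ map Letter v'" by (elim sound_CancelE)
    \<comment> \<open>Grouped so that the inner cancelling pair can be replaced by the identity,
      after which the outer pair cancels in the factor.\<close>
    have "\<pi> (map (tagged i) u @ u') \<otimes> \<pi> (v' @ map (tagged i) v) =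
        \<rho> i u \<otimes> ((\<pi> u' \<otimes> \<pi> v') \<otimes> \<rho> i v)"
      using uv(1,2) cancel(2,3) tl by (simp add: simps del: in_lists_conv_set)
    also have "\<dots> = \<one>"
      using cancel(2-4) unfolding uv(3) by (simp add: \<rho>_R_append \<rho>_R_closed)
    finally show ?thesis
      using uv y tl cancel(1)
      by (auto intro!: soundI(2)[of "map (tagged i) u @ u'" "v' @ map (tagged i) v"])
  next
    case (merge i u v w)
    with z obtain x y where z: "z = ?t i u @ x @ ?t i v @ y @ ?t i (rev w)"
      "x \<in> sound Cancel" "y \<in> sound Copy"
      by (auto simp: interp_append)
    note tl = merge(2)[THEN tagged_R_lists] merge(3)[THEN tagged_R_lists]
      merge(4)[THEN tagged_R_lists]
    from z(2) obtain u' v' where uv: "u' \<in> lists A'" "v' \<in> lists A'" "\<pi> u' \<otimes> \<pi> v' = \<one>"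
      "x = map Letter u' @ [Hash1] @ map Letter v'" by (elim sound_CancelE)
    from z(3) obtain v'' w' where vw: "v'' \<in> lists A'" "w' \<in> lists A'" "\<pi> v'' = \<pi> w'"
      "y = map Letter v'' @ [Hash2] @ map Letter (rev w')" by (elim sound_CopyE)
    let ?u = "map (tagged i) u @ u'" and ?v = "v' @ map (tagged i) v @ v''"
      and ?w = "map (tagged i) w @ w'"
    \<comment> \<open>Once the cancelled middle is gone, the outer blocks merge to the value of
      \<open>w\<close> and the copied tails agree.\<close>
    have "\<pi> ?u \<otimes> \<pi> ?v = \<rho> i u \<otimes> ((\<pi> u' \<otimes> \<pi> v') \<otimes> (\<rho> i v \<otimes> \<pi> v''))"
      using uv(1,2) vw(1) merge(2,3) tl by (simp add: simps del: in_lists_conv_set)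
    also have "\<dots> = (\<rho> i u \<otimes> \<rho> i v) \<otimes> \<pi> v''"
      using merge(2,3) vw(1) unfolding uv(3) by (simp add: simps del: in_lists_conv_set)
    also have "\<dots> = \<pi> ?w"
      using merge(2-5) vw tl by (simp add: simps \<rho>_R_append[symmetric] del: in_lists_conv_set)
    finally show ?thesis
      using uv vw z(1) tl merge(1)
      by (auto intro!: soundI(1)[of ?u ?v ?w] simp: rev_map)
  qed
qed

lemma P_sound:
  assumes "z \<in> generated_language P Product"
  obtains u v w where "z = marked_product u v w" "u \<in> lists A'" "v \<in> lists A'" "w \<in> lists A'"
    "\<pi> u \<otimes> \<pi> v = \<pi> w"
proof -
  from assms have "z \<in> interp sound [Nonterminal Product]"
    unfolding generated_language_eq mem_Collect_eq by (rule yields_in_interp[OF _ interp_sound])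
  then have "z \<in> sound Product" by simp
  then show thesis by (rule sound_ProductE) (use that in auto)
qed


end

section \<open>Completeness of the product grammar\<close>

context combing_pair
begin

abbreviation marked_word :: "(bool \<times> nat list) list \<Rightarrow> nat marked list" where
  "marked_word bs \<equiv> map Letter (block_word bs)"

text \<open>One copy production per pair of blocks, outermost first. With \<open>Product\<close>
  this handles the blocks before the seam, with \<open>Copy\<close> those behind it.\<close>

lemma yields_copy:
  assumes X: "X = Product \<or> X = Copy" and m: "yields P [Nonterminal X] m"
  shows "bs \<in> alternating B \<Longrightarrow> ds \<in> alternating B \<Longrightarrow> map val bs = map val ds \<Longrightarrow>
    yields P [Nonterminal X] (marked_word bs @ m @ map Letter (rev (block_word ds)))"
proof (induction bs arbitrary: ds)
  case Nil
  with m show ?case by simp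
next
  case (Cons b bs)
  obtain i u where b: "b = (i, u)" by fastforce
  with Cons.prems(3) obtain w ds' where ds: "ds = (i, w) # ds'" "\<rho> i u = \<rho> i w"
    "map val bs = map val ds'" by (cases ds) auto
  from Cons.prems b ds have "u \<in> R i" "w \<in> R i" "bs \<in> alternating B" "ds' \<in> alternating B"
    by (auto simp: alternating_Cons B_R)
  with Cons.IH[of ds'] ds
  have "yields P [Nonterminal X] (marked_word bs @ m @ map Letter (rev (block_word ds')))"
    and prod: "(X, letters i u @ [Nonterminal X] @ letters i (rev w)) \<in> P"
    using P_copy[OF X] by blast+
  then have "yields P (letters i u @ [Nonterminal X] @ letters i (rev w))
      (map Letter (map (tagged i) u) @ (marked_word bs @ m @ map Letter (rev (block_word ds'))) @
        map Letter (map (tagged i) (rev w)))"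
    by (intro yields_appendI yields_letters)
  with prod b ds show ?case by (auto simp: yields_single rev_map)
qed

lemma yields_split:
  "yields P [Nonterminal Cancel] x \<Longrightarrow> yields P [Nonterminal Copy] y \<Longrightarrow>
    yields P [Nonterminal Product] (x @ y)"
  using P_split yields_appendI[of P "[Nonterminal Cancel]" x "[Nonterminal Copy]" y]
  by (auto simp: yields_single)

lemma yields_Copy_words:
  assumes "bs \<in> alternating B" "ds \<in> alternating B" "map val bs = map val ds"
  shows "yields P [Nonterminal Copy] (marked_word bs @ [Hash2] @ map Letter (rev (block_word ds)))"
proof -
  have "yields P [Nonterminal Copy] [Hash2]"
    unfolding yields_single using P_hash2 yields_map_Terminal[of P "[Hash2]" "[Hash2]"] by auto
  with assms show ?thesis by (intro yields_copy) auto
qed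

lemma seq_prod_append:
  assumes "bs \<in> alternating B" "cs \<in> alternating B"
  shows "seq_prod M (map val (bs @ cs)) = seq_prod M (map val bs) \<otimes> seq_prod M (map val cs)"
  using assms(1)
proof (induction bs)
  case Nil
  then show ?case using seq_prod_val_closed[OF assms(2)] by simp
next
  case (Cons b bs)
  obtain i u where b: "b = (i, u)" by fastforce
  with Cons.prems have "u \<in> R i" "bs \<in> alternating B" by (auto simp: alternating_Cons B_R)
  with Cons.IH b assms(2) show ?case
    by (simp add: m_assoc \<rho>_R_closed seq_prod_val_closed)
qed

text \<open>The word \<open>m\<close> collects the factors cancelled so far around the first marker; the derivation
  either cancels another pair of factors or decides how the remaining factors combine.\<close>

lemma yields_product:
  assumes "bs \<in> alternating B" "cs \<in> alternating B" "ds \<in> alternating B"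
    and "seq_prod M (map val bs) \<otimes> seq_prod M (map val cs) = seq_prod M (map val ds)"
    and "yields P [Nonterminal Cancel] m"
  shows "yields P [Nonterminal Product]
    (marked_word bs @ m @ marked_word cs @ [Hash2] @ map Letter (rev (block_word ds)))"
  using assms
proof (induction bs arbitrary: cs m rule: length_induct)
  case (1 bs)
  note ds = \<open>ds \<in> alternating B\<close> and m = \<open>yields P [Nonterminal Cancel] m\<close>
  show ?case
  proof (cases "bs @ cs \<in> alternating B")
    \<comment> \<open>Nothing interacts at the seam: the concatenation is a normal form, so
      \<open>ds\<close> splits into a part matching \<open>bs\<close>, copied around
      \<open>Product\<close>, and a part matching \<open>cs\<close>, derived from
      \<open>Copy\<close>.\<close>
    case True
    then have "map val (bs @ cs) = map val ds"
      using 1(2-5) seq_prod_append[OF 1(2,3)]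
      by (intro normal_form_unique val_alternating) simp_all
    then have "map val ds = map val bs @ map val cs" by simp
    then obtain ds1 ds2 where d: "ds = ds1 @ ds2" "map val bs = map val ds1" "map val cs = map val ds2"
      unfolding map_eq_append_conv by metis
    with ds have d': "ds1 \<in> alternating B" "ds2 \<in> alternating B" by (auto simp: alternating_append)
    from yields_Copy_words[OF 1(3) d'(2) d(3)] yields_split[OF m]
    have "yields P [Nonterminal Product] (m @ marked_word cs @ [Hash2] @ map Letter (rev (block_word ds2)))"
      by blast
    from yields_copy[OF _ this 1(2) d'(1) d(2)] d(1) show ?thesis by simp
  next
    case False
    with 1(2,3) have "bs \<noteq> []" "cs \<noteq> []" "fst (last bs) = fst (hd cs)"
      by (auto simp: alternating_append)
    then obtain bs' i u cs' v where b: "bs = bs' @ [(i, u)]" and c: "cs = (i, v) # cs'"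
      by (cases bs rule: rev_cases; cases cs) auto
    with 1(2,3) have bs': "bs' \<in> alternating B" "bs' = [] \<or> fst (last bs') \<noteq> i" "u \<in> R i"
      and cs': "cs' \<in> alternating B" "cs' = [] \<or> fst (hd cs') \<noteq> i" "v \<in> R i"
      and u: "[(i, u)] \<in> alternating B"
      by (auto simp: alternating_append alternating_Cons B_R)
    let ?p = "\<rho> i u \<otimes> \<rho> i v"
    let ?L = "seq_prod M (map val bs')" and ?R = "seq_prod M (map val cs')"
    have closed: "\<rho> i u \<in> carrier M" "\<rho> i v \<in> carrier M" "?L \<in> carrier M" "?R \<in> carrier M"
      using bs' cs' by (auto intro: \<rho>_R_closed seq_prod_val_closed)
    have "seq_prod M (map val bs) = ?L \<otimes> \<rho> i u"
      unfolding b seq_prod_append[OF bs'(1) u] using closed by simp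
    with 1(5) c closed have prod: "?L \<otimes> (?p \<otimes> ?R) = seq_prod M (map val ds)"
      by (simp add: m_assoc)
    show ?thesis
    proof (cases "?p = \<one>")
      case True
      \<comment> \<open>Blocks with product one are wrapped around \<open>m\<close>, and the
        induction hypothesis applies to the shorter \<open>bs'\<close>.\<close>
      have "(Cancel, letters i u @ [Nonterminal Cancel] @ letters i v) \<in> P"
        using bs' cs' True by (intro P_cancel) (simp_all add: \<rho>_R_append)
      moreover have "yields P (letters i u @ [Nonterminal Cancel] @ letters i v)
          (map Letter (map (tagged i) u) @ m @ map Letter (map (tagged i) v))"
        using m by (intro yields_appendI yields_letters)
      ultimately have "yields P [Nonterminal Cancel]
          (map Letter (map (tagged i) u) @ m @ map Letter (map (tagged i) v))"
        unfolding yields_single by blast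
      moreover have "?L \<otimes> ?R = seq_prod M (map val ds)" using prod True closed by simp
      ultimately show ?thesis
        using 1(1)[rule_format, of bs' cs' "map Letter (map (tagged i) u) @ m @ map Letter (map (tagged i) v)"]
          bs' cs' ds b c by simp
    next
      case False
      have p: "?p \<in> N i" using bs' cs' by (metis \<rho>_R factor_mult image_eqI)
      \<comment> \<open>The seam blocks merge to one nontrivial entry whose neighbours lie in the
        other factor. The result is a normal form, so the values of \<open>ds\<close> are this very
        sequence and some block \<open>w\<close> represents the merged entry.\<close>
      let ?s = "map val bs' @ (i, ?p) # map val cs'"
      have "?s \<in> alternating (\<lambda>i. N i - {\<one>})"
        using bs' cs' p False val_alternating[OF bs'(1)] val_alternating[OF cs'(1)]
        by (auto simp: alternating_append alternating_Cons last_map hd_map split: prod.splits)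
      \<comment> \<open>The merged entry is an element and not yet the value of a chosen block, so
        \<open>seq_prod_append\<close> does not cover this product.\<close>
      moreover have "seq_prod M (map val bs' @ t) = ?L \<otimes> seq_prod M t"
        if "seq_prod M t \<in> carrier M" for t
        using bs'(1)
      proof (induction bs')
        case (Cons x xs)
        obtain j w where "x = (j, w)" by fastforce
        with Cons that show ?case
          by (simp add: alternating_Cons m_assoc \<rho>_R_closed B_R seq_prod_val_closed)
      qed (use that in simp)
      then have "seq_prod M ?s = seq_prod M (map val ds)" using prod closed by simp
      ultimately have "?s = map val ds"
        using ds by (intro normal_form_unique val_alternating)
      then obtain ds1 w ds2 where d: "ds = ds1 @ (i, w) # ds2" "map val bs' = map val ds1"
        "?p = \<rho> i w" "map val cs' = map val ds2"
        by (auto simp: append_eq_map_conv Cons_eq_map_conv)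
      with ds have d': "ds1 \<in> alternating B" "ds2 \<in> alternating B" "w \<in> R i"
        by (auto simp: alternating_append alternating_Cons B_R)
      have "(Product, letters i u @ [Nonterminal Cancel] @ letters i v @ [Nonterminal Copy] @
          letters i (rev w)) \<in> P"
        using bs' cs' d' d(3) by (intro P_merge) (simp_all add: \<rho>_R_append)
      moreover have "yields P (letters i u @ [Nonterminal Cancel] @ letters i v @ [Nonterminal Copy] @
          letters i (rev w)) (map Letter (map (tagged i) u) @ m @ map Letter (map (tagged i) v) @
          (marked_word cs' @ [Hash2] @ map Letter (rev (block_word ds2))) @
          map Letter (map (tagged i) (rev w)))"
        using m yields_Copy_words[OF cs'(1) d'(2) d(4)]
        by (intro yields_appendI yields_letters)
      ultimately have "yields P [Nonterminal Product] (map Letter (map (tagged i) u) @ m @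
          map Letter (map (tagged i) v) @
          (marked_word cs' @ [Hash2] @ map Letter (rev (block_word ds2))) @
          map Letter (map (tagged i) (rev w)))"
        unfolding yields_single by blast
      from yields_copy[OF _ this bs'(1) d'(1) d(2)] show ?thesis
        unfolding b c d(1) by (simp add: rev_map)
    qed
  qed
qed

text \<open>Completeness comes from \<open>yields_product\<close>, starting with nothing cancelled.
  For soundness, unique parsing of marked words identifies the parts supplied by
  \<open>P_sound\<close> with the given ones.\<close>

lemma generates_table:
  assumes "u \<in> R'" "v \<in> R'" "w \<in> R'"
  shows "marked_product u v w \<in> generated_language P Product \<longleftrightarrow> \<pi> (u @ v) = \<pi> w"
proof
  from assms obtain bs cs ds where b: "bs \<in> alternating B" "u = block_word bs"
    "cs \<in> alternating B" "v = block_word cs" "ds \<in> alternating B" "w = block_word ds"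
    by (auto simp: R'_def)
  have "yields P [Nonterminal Cancel] [Hash1]"
    unfolding yields_single using P_hash1 yields_map_Terminal[of P "[Hash1]" "[Hash1]"] by auto
  moreover assume "\<pi> (u @ v) = \<pi> w"
  then have "seq_prod M (map val bs) \<otimes> seq_prod M (map val cs) = seq_prod M (map val ds)"
    using b by (simp add: \<pi>_append block_word_lists \<pi>_block_word del: in_lists_conv_set)
  ultimately show "marked_product u v w \<in> generated_language P Product"
    using yields_product[of bs cs ds "[Hash1]"] b by (simp add: generated_language_eq)
next
  assume "marked_product u v w \<in> generated_language P Product"
  then obtain u' v' w' where *: "u' \<in> lists A'" "v' \<in> lists A'" "w' \<in> lists A'" "\<pi> u' \<otimes> \<pi> v' = \<pi> w'"
    and "marked_product u v w = marked_product u' v' w'"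
    by (elim P_sound)
  from this(5)[unfolded marked_product_eq_iff] * show "\<pi> (u @ v) = \<pi> w"
    by (simp add: \<pi>_append del: in_lists_conv_set)
qed

section \<open>Properties of the combing of the free product\<close>

lemma regular_R': "regular_language A' R'"
  unfolding A'_def R'_def
proof (rule regular_language_alternating)
  show "regular_language (A i) (B i)" for i
    unfolding B_def by (rule regular_language_remove[OF regular_R])
  show "[] \<notin> B i" for i
    using e(3)[of "[]" i] \<rho>_Nil by (auto simp: B_def)
qed

lemma context_free_table: "context_free (multiplication_table \<pi> R')"
proof -
  have "multiplication_table \<pi> R' = {marked_product u v w |u v w.
      u \<in> R' \<and> v \<in> R' \<and> w \<in> R' \<and> marked_product u v w \<in> generated_language P Product}"
    unfolding multiplication_table_def using generates_table by blast
  with context_free_restrict_regular[OF context_free_P regular_R'] show ?thesis by simp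
qed

lemma \<pi>_R': "\<pi> ` R' = carrier M"
proof (intro equalityI subsetI)
  fix x assume "x \<in> carrier M"
  then obtain s where s: "s \<in> alternating (\<lambda>i. N i - {\<one>})" "seq_prod M s = x"
    using normal_form_exists by blast
  then obtain bs where "bs \<in> alternating B" "map val bs = s" using val_surj by blast
  with s have "block_word bs \<in> R'" "x = \<pi> (block_word bs)"
    by (simp_all add: R'_def \<pi>_block_word)
  then show "x \<in> \<pi> ` R'" by blast
qed (auto simp: R'_def intro!: \<pi>_closed[OF block_word_lists])

lemma word_hyperbolic: "word_hyperbolic_wrt M A' \<pi> R'"
proof -
  have "finite A'" using finite_alphabet by (simp add: A'_def)
  moreover have "\<pi> \<in> hom (free_monoid A') M"
    by (rule homI) (simp_all add: free_monoid_def \<pi>_append \<pi>_closed del: in_lists_conv_set)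
  moreover have "\<pi> [] = \<one>" by (simp add: \<pi>_def)
  moreover have "R' \<subseteq> lists A'" using block_word_lists by (auto simp: R'_def)
  then have "\<pi> ` lists A' = carrier M"
    using \<pi>_R' \<pi>_closed by blast
  ultimately show ?thesis
    using regular_R' \<pi>_R' context_free_table
    by (simp add: word_hyperbolic_wrt_def generated_via_def regular_combing_def)
qed

text \<open>The normal form of the identity is the empty sequence, whichever words
  \<open>e i\<close> represent the identity in the factors.\<close>

lemma identity_word_free_product: "{w \<in> R'. \<pi> w = \<one>} = {[]}"
proof (intro equalityI subsetI)
  fix w assume "w \<in> {w \<in> R'. \<pi> w = \<one>}"
  then obtain bs where bs: "bs \<in> alternating B" "w = block_word bs" "\<pi> (block_word bs) = \<one>"
    by (auto simp: R'_def)
  then have "map val bs = map val []" by (intro val_unique) (simp_all add: \<pi>_def)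
  with bs show "w \<in> {[]}" by simp
next
  fix w :: "nat list" assume "w \<in> {[]}"
  moreover have "[] \<in> R'" unfolding R'_def by (rule image_eqI[of _ _ "[]"]) simp_all
  ultimately show "w \<in> {w \<in> R'. \<pi> w = \<one>}" by (simp add: \<pi>_def)
qed

text \<open>When each element of a factor has only one combing word, the elements fixed by
  \<open>val_unique\<close> fix the blocks too.\<close>

lemma bij_betw_free_product:
  assumes "\<And>i. inj_on (\<rho> i) (R i)"
  shows "bij_betw \<pi> R' (carrier M)"
proof -
  have "inj_on \<pi> R'"
  proof (rule inj_onI)
    fix u v assume "u \<in> R'" "v \<in> R'" "\<pi> u = \<pi> v"
    then obtain bs cs where b: "bs \<in> alternating B" "u = block_word bs"
      "cs \<in> alternating B" "v = block_word cs" "\<pi> (block_word bs) = \<pi> (block_word cs)"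
      by (auto simp: R'_def)
    then have "map val bs = map val cs" by (intro val_unique)
    have "inj_on val (Sigma UNIV R)"
      using assms by (auto simp: inj_on_def)
    moreover have "set bs \<union> set cs \<subseteq> Sigma UNIV R"
      using b by (auto simp: alternating_def B_def)
    ultimately have "inj_on val (set bs \<union> set cs)" by (rule inj_on_subset)
    with b \<open>map val bs = map val cs\<close> show "u = v" by (simp add: inj_on_map_eq_map)
  qed
  with \<pi>_R' show ?thesis by (simp add: bij_betw_def)
qed

end

section \<open>Transfer along isomorphisms\<close>

lemma (in free_factors) monoid_factor: "monoid (M\<lparr>carrier := N i\<rparr>)"
  using factor_subset[of i] factor_one[of i] factor_mult
  by unfold_locales (auto simp: subset_iff m_assoc)

text \<open>Alphabet and combing are kept and only the evaluation is composed with \<open>h\<close>.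
  Injectivity of \<open>h\<close> leaves the multiplication table literally unchanged.\<close>

lemma word_hyperbolic_wrt_iso:
  assumes "monoid M" "monoid M'" "h \<in> iso M M'" "word_hyperbolic_wrt M A \<pi> R"
  shows "word_hyperbolic_wrt M' A (h \<circ> \<pi>) R" "R \<subseteq> lists A" "h \<one>\<^bsub>M\<^esub> = \<one>\<^bsub>M'\<^esub>"
proof -
  interpret M: monoid M by fact
  interpret M': monoid M' by fact
  from assms(3) have h: "h \<in> hom M M'" "inj_on h (carrier M)" "h ` carrier M = carrier M'"
    by (auto simp: iso_def bij_betw_def)
  from assms(4) have \<pi>: "finite A" "\<pi> \<in> hom (free_monoid A) M" "\<pi> [] = \<one>\<^bsub>M\<^esub>"
    "\<pi> ` lists A = carrier M" "regular_language A R" "\<pi> ` R = carrier M"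
    "context_free (multiplication_table \<pi> R)"
    by (auto simp: word_hyperbolic_wrt_def generated_via_def regular_combing_def)
  show one: "h \<one>\<^bsub>M\<^esub> = \<one>\<^bsub>M'\<^esub>"
  proof (rule M'.one_unique)
    fix x assume "x \<in> carrier M'"
    with h(3) obtain y where "y \<in> carrier M" "x = h y" by blast
    with hom_mult[OF h(1) M.one_closed, of y] show "h \<one>\<^bsub>M\<^esub> \<otimes>\<^bsub>M'\<^esub> x = x" by simp
  qed (rule hom_in_carrier[OF h(1) M.one_closed])
  show R: "R \<subseteq> lists A" using \<pi>(5) by (auto simp: regular_language_def)
  have closed: "\<pi> u \<in> carrier M" if "u \<in> lists A" for u using that \<pi>(4) by blast
  have "(h \<circ> \<pi>) (u @ v) = (h \<circ> \<pi>) w \<longleftrightarrow> \<pi> (u @ v) = \<pi> w" if "u \<in> R" "v \<in> R" "w \<in> R" for u v w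
  proof -
    have "u @ v \<in> lists A" "w \<in> lists A" using that R by auto
    with closed h(2) show ?thesis by (simp add: inj_on_eq_iff del: in_lists_conv_set)
  qed
  then have "multiplication_table (h \<circ> \<pi>) R = multiplication_table \<pi> R"
    unfolding multiplication_table_def by blast
  moreover have "h \<circ> \<pi> \<in> hom (free_monoid A) M'" by (rule hom_compose[OF \<pi>(2) h(1)])
  moreover have "(h \<circ> \<pi>) ` X = h ` \<pi> ` X" for X by (simp add: image_comp)
  ultimately show "word_hyperbolic_wrt M' A (h \<circ> \<pi>) R"
    unfolding word_hyperbolic_wrt_def generated_via_def regular_combing_def
    using \<pi> h(3) one by simp
qed

lemma word_hyperbolic_with_uniqueness_iso:
  assumes "monoid M" "monoid M'" "M \<cong> M'" "word_hyperbolic_with_uniqueness M"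
  shows "word_hyperbolic_with_uniqueness M'"
proof -
  from assms obtain h A \<pi> R where h: "h \<in> iso M M'" and
    *: "word_hyperbolic_wrt M (A :: nat set) \<pi> R" "bij_betw \<pi> R (carrier M)"
    by (auto simp: is_iso_def word_hyperbolic_with_uniqueness_def)
  moreover have "bij_betw h (carrier M) (carrier M')" using h by (simp add: iso_def)
  ultimately show ?thesis
    unfolding word_hyperbolic_with_uniqueness_def
    using word_hyperbolic_wrt_iso(1)[OF assms(1,2) h *(1)] bij_betw_trans by blast
qed

lemma word_hyperbolic_with_1_uniqueness_iso:
  assumes "monoid M" "monoid M'" "M \<cong> M'" "word_hyperbolic_with_1_uniqueness M"
  shows "word_hyperbolic_with_1_uniqueness M'"
proof -
  from assms obtain h A \<pi> R where h: "h \<in> iso M M'" and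
    *: "word_hyperbolic_wrt M (A :: nat set) \<pi> R" "{w \<in> R. \<pi> w = \<one>\<^bsub>M\<^esub>} = {[]}"
    by (auto simp: is_iso_def word_hyperbolic_with_1_uniqueness_def)
  note iso = word_hyperbolic_wrt_iso[OF assms(1,2) h *(1)]
  interpret M: monoid M by fact
  have "h (\<pi> w) = \<one>\<^bsub>M'\<^esub> \<longleftrightarrow> \<pi> w = \<one>\<^bsub>M\<^esub>" if "w \<in> R" for w
  proof -
    have "\<pi> w \<in> carrier M"
      using that *(1) by (auto simp: word_hyperbolic_wrt_def regular_combing_def)
    then show ?thesis
      unfolding iso(3)[symmetric] using h by (intro inj_on_eq_iff) (auto simp: iso_def bij_betw_def)
  qed
  with *(2) have "{w \<in> R. (h \<circ> \<pi>) w = \<one>\<^bsub>M'\<^esub>} = {[]}" by auto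
  with iso(1) show ?thesis unfolding word_hyperbolic_with_1_uniqueness_def by blast
qed

section \<open>The two variants for internal free products\<close>

lemma (in free_factors) word_hyperbolic_with_1_uniqueness_free_product:
  assumes "\<And>i. word_hyperbolic_with_1_uniqueness (M\<lparr>carrier := N i\<rparr>)"
  shows "word_hyperbolic_with_1_uniqueness M"
proof -
  define combing where "combing i A \<rho> R \<longleftrightarrow>
      word_hyperbolic_wrt (M\<lparr>carrier := N i\<rparr>) A \<rho> R \<and> {w \<in> R. \<rho> w = \<one>} = {[]}"
    for i and A :: "nat set" and \<rho> R
  have "\<exists>A \<rho> R. combing i A \<rho> R" for i
    using assms[of i] by (simp add: word_hyperbolic_with_1_uniqueness_def combing_def)
  then obtain A \<rho> R where "\<And>i. combing i (A i) (\<rho> i) (R i)" by metis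
  then interpret combing_pair M N A \<rho> R "\<lambda>_. []"
    by unfold_locales (simp_all add: combing_def)
  show ?thesis
    unfolding word_hyperbolic_with_1_uniqueness_def
    using word_hyperbolic identity_word_free_product by blast
qed

lemma (in free_factors) word_hyperbolic_with_uniqueness_free_product:
  assumes "\<And>i. word_hyperbolic_with_uniqueness (M\<lparr>carrier := N i\<rparr>)"
  shows "word_hyperbolic_with_uniqueness M"
proof -
  define combing where "combing i A \<rho> R \<longleftrightarrow>
      word_hyperbolic_wrt (M\<lparr>carrier := N i\<rparr>) A \<rho> R \<and> bij_betw \<rho> R (N i)"
    for i and A :: "nat set" and \<rho> R
  have "\<exists>A \<rho> R. combing i A \<rho> R" for i
    using assms[of i] by (simp add: word_hyperbolic_with_uniqueness_def combing_def)
  then obtain A \<rho> R where "\<And>i. combing i (A i) (\<rho> i) (R i)" by metis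
  then have *: "word_hyperbolic_wrt (M\<lparr>carrier := N i\<rparr>) (A i) (\<rho> i) (R i)"
    "bij_betw (\<rho> i) (R i) (N i)" for i
    by (simp_all add: combing_def)
  \<comment> \<open>Bijectivity provides exactly one word for the identity, which need not be
    empty.\<close>
  define e where "e i = inv_into (R i) (\<rho> i) \<one>" for i
  have "{w \<in> R i. \<rho> i w = \<one>} = {e i}" for i
  proof -
    have "inj_on (\<rho> i) (R i)" "\<one> \<in> \<rho> i ` R i"
      using *(2)[of i] factor_one[of i] by (simp_all add: bij_betw_def)
    then show ?thesis unfolding e_def
      by (auto simp: f_inv_into_f intro: inv_into_into inv_into_f_eq[symmetric])
  qed
  with * interpret combing_pair M N A \<rho> R e by unfold_locales
  show ?thesis
    unfolding word_hyperbolic_with_uniqueness_def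
    using word_hyperbolic bij_betw_free_product *(2) by (metis bij_betw_imp_inj_on)
qed

text \<open>Identifies an abstract factor with a submonoid of the free product: both are images of
  the words over the factor's alphabet with the same kernel.\<close>

lemma iso_factor:
  assumes "has_presentation M\<^sub>1 A\<^sub>1 \<R>\<^sub>1" and \<phi>: "\<phi> \<in> hom (free_monoid A) M" "A\<^sub>1 \<subseteq> A"
    and ker: "\<And>u v. u \<in> lists A\<^sub>1 \<Longrightarrow> v \<in> lists A\<^sub>1 \<Longrightarrow>
      \<phi> u = \<phi> v \<longleftrightarrow> (u, v) \<in> presentation_congruence A\<^sub>1 \<R>\<^sub>1"
  shows "M\<^sub>1 \<cong> M\<lparr>carrier := \<phi> ` lists A\<^sub>1\<rparr>"
proof -
  obtain \<psi> where
    \<psi>: "\<psi> \<in> hom (free_monoid A\<^sub>1) M\<^sub>1" "\<psi> [] = \<one>\<^bsub>M\<^sub>1\<^esub>" "\<psi> ` lists A\<^sub>1 = carrier M\<^sub>1"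
    "\<forall>u\<in>lists A\<^sub>1. \<forall>v\<in>lists A\<^sub>1. \<psi> u = \<psi> v \<longleftrightarrow> (u, v) \<in> presentation_congruence A\<^sub>1 \<R>\<^sub>1"
    by (rule presentation_map[OF assms(1)])
  have "\<phi> \<in> hom (free_monoid A\<^sub>1) (M\<lparr>carrier := \<phi> ` lists A\<^sub>1\<rparr>)"
  proof (rule homI)
    fix u v assume "u \<in> carrier (free_monoid A\<^sub>1)" "v \<in> carrier (free_monoid A\<^sub>1)"
    then have "u \<in> lists A" "v \<in> lists A"
      using lists_mono[OF \<phi>(2)] by (auto simp only: free_monoid_def partial_object.simps)
    with hom_mult[OF \<phi>(1), of u v]
    show "\<phi> (u \<otimes>\<^bsub>free_monoid A\<^sub>1\<^esub> v) = \<phi> u \<otimes>\<^bsub>M\<lparr>carrier := \<phi> ` lists A\<^sub>1\<rparr>\<^esub> \<phi> v"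
      by (simp add: free_monoid_def)
  qed (simp add: free_monoid_def)
  with \<psi> ker show ?thesis by (intro iso_of_same_kernel[of \<psi> A\<^sub>1 _ \<phi>]) simp_all
qed

theorem theorem2:
  fixes M\<^sub>1 :: "('m, 'x) monoid_scheme" and M\<^sub>2 :: "('n, 'y) monoid_scheme"
    and M :: "('p, 'z) monoid_scheme"
    and A\<^sub>1 A\<^sub>2 :: "'a set" and \<R>\<^sub>1 \<R>\<^sub>2 :: "('a list \<times> 'a list) set"
  assumes "has_presentation M\<^sub>1 A\<^sub>1 \<R>\<^sub>1" and "has_presentation M\<^sub>2 A\<^sub>2 \<R>\<^sub>2" and "A\<^sub>1 \<inter> A\<^sub>2 = {}"
    and "has_presentation M (A\<^sub>1 \<union> A\<^sub>2) (\<R>\<^sub>1 \<union> \<R>\<^sub>2)"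
  shows "(word_hyperbolic_with_1_uniqueness M\<^sub>1 \<and> word_hyperbolic_with_1_uniqueness M\<^sub>2 \<longrightarrow>
            word_hyperbolic_with_1_uniqueness M) \<and>
         (word_hyperbolic_with_uniqueness M\<^sub>1 \<and> word_hyperbolic_with_uniqueness M\<^sub>2 \<longrightarrow>
            word_hyperbolic_with_uniqueness M)"
proof -
  define A where "A i = (if i then A\<^sub>2 else A\<^sub>1)" for i
  define \<R> where "\<R> i = (if i then \<R>\<^sub>2 else \<R>\<^sub>1)" for i
  have monoids: "monoid M\<^sub>1" "monoid M\<^sub>2" "monoid M"
    using assms by (auto simp: has_presentation_def)
  have union: "A\<^sub>1 \<union> A\<^sub>2 = A False \<union> A True" "\<R>\<^sub>1 \<union> \<R>\<^sub>2 = \<R> False \<union> \<R> True"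
    by (simp_all add: A_def \<R>_def)
  interpret presentation_pair A \<R>
    using assms by unfold_locales (auto simp: has_presentation_def A_def \<R>_def)
  obtain \<phi> where
    \<phi>: "\<phi> \<in> hom (free_monoid (A False \<union> A True)) M" "\<phi> [] = \<one>\<^bsub>M\<^esub>"
      "\<phi> ` lists (A False \<union> A True) = carrier M"
    and "\<forall>u\<in>lists (A False \<union> A True). \<forall>v\<in>lists (A False \<union> A True).
      \<phi> u = \<phi> v \<longleftrightarrow> (u, v) \<in> C'"
    by (rule presentation_map[OF assms(4)[unfolded union]])
  then have ker: "\<phi> u = \<phi> v \<longleftrightarrow> (u, v) \<in> C'"
    if "u \<in> lists (A False \<union> A True)" "v \<in> lists (A False \<union> A True)" for u v
    using that by blast
  interpret free_factors M "\<lambda>i. \<phi> ` lists (A i)"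
    by (rule free_factors[OF monoids(3) \<phi> ker])
  \<comment> \<open>By \<open>congruence_factor\<close> the kernel restricted to one alphabet is the
    congruence of that factor, which is what \<open>iso_factor\<close> asks for.\<close>
  have "\<phi> u = \<phi> v \<longleftrightarrow> (u, v) \<in> C i" if "u \<in> lists (A i)" "v \<in> lists (A i)" for i u v
    using that ker[of u v] lists_mono[OF subset_generators(1)[of i]] congruence_factor[OF that] by blast
  note factor = iso_factor[OF _ \<phi>(1) subset_generators(1) this]
  have iso: "M\<^sub>1 \<cong> M\<lparr>carrier := \<phi> ` lists (A False)\<rparr>" "M\<^sub>2 \<cong> M\<lparr>carrier := \<phi> ` lists (A True)\<rparr>"
    using factor[of M\<^sub>1 False] factor[of M\<^sub>2 True] assms(1,2) by (auto simp: A_def \<R>_def)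
  show ?thesis
  proof (intro conjI impI; elim conjE)
    assume "word_hyperbolic_with_1_uniqueness M\<^sub>1" "word_hyperbolic_with_1_uniqueness M\<^sub>2"
    then have "word_hyperbolic_with_1_uniqueness (M\<lparr>carrier := \<phi> ` lists (A i)\<rparr>)" for i
      using word_hyperbolic_with_1_uniqueness_iso[OF monoids(1) monoid_factor iso(1)]
        word_hyperbolic_with_1_uniqueness_iso[OF monoids(2) monoid_factor iso(2)]
      by (cases i) simp_all
    then show "word_hyperbolic_with_1_uniqueness M"
      by (rule word_hyperbolic_with_1_uniqueness_free_product)
  next
    assume "word_hyperbolic_with_uniqueness M\<^sub>1" "word_hyperbolic_with_uniqueness M\<^sub>2"
    then have "word_hyperbolic_with_uniqueness (M\<lparr>carrier := \<phi> ` lists (A i)\<rparr>)" for i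
      using word_hyperbolic_with_uniqueness_iso[OF monoids(1) monoid_factor iso(1)]
        word_hyperbolic_with_uniqueness_iso[OF monoids(2) monoid_factor iso(2)]
      by (cases i) simp_all
    then show "word_hyperbolic_with_uniqueness M"
      by (rule word_hyperbolic_with_uniqueness_free_product)
  qed
qed

end
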